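(* Let $(M,g)$ be a gradient Einstein-type manifold with $\beta\neq0$ of dimension $m\geq3$. Then the following integrability conditions hold: $$\alpha C_{ijk}+\beta f_tW_{tijk}=\left[\beta-\frac{(m-2)\alpha\mu}{\beta}\right]D_{ijk},$$ $$\alpha B_{ij}=\frac{1}{m-2}\left\{\left[\beta-\frac{(m-2)\alpha\mu}{\beta}\right]D_{ijk,k}+\beta\left(\frac{m-3}{m-2}\right)f_tC_{jit}-\mu f_tf_kW_{itjk}\right\}.$$
   Context: $(M,g)$ is a smooth connected Riemannian manifold of dimension $m\ge 3$ with Ricci tensor $\operatorname{Ric}$ and scalar curvature $S$. It is a gradient Einstein-type manifold if there exist $f,\lambda\in C^\infty(M)$ and constants $\alpha,\beta,\mu,\rho\in\mathbb{R}$, $(\alpha,\beta,\mu)\ne(0,0,0)$, such that $\alpha\operatorname{Ric}+\beta\operatorname{Hess}(f)+\mu\,df\otimes df=(\rho S+\lambda)g$. Components are taken in a local orthonormal frame, repeated indices are summed, indices after a comma denote covariant derivatives, and $f_i$ are the components of $df$. Curvature convention: $R_{ij}=R_{itjt}$, $S=R_{tt}$, and the Weyl tensor $W$ is defined by $R_{ijkt}=W_{ijkt}+\frac{1}{m-2}(R_{ik}\delta_{jt}-R_{it}\delta_{jk}+R_{jt}\delta_{ik}-R_{jk}\delta_{it})-\frac{S}{(m-1)(m-2)}(\delta_{ik}\delta_{jt}-\delta_{it}\delta_{jk})$. The Riemann tensor is signed so that third covariant derivatives of a function $f$ satisfy $f_{ijk}=f_{ikj}+f_tR_{tijk}$, where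 $\operatorname{Hess}(f)=f_{ij}\theta^j\otimes\theta^i$. The Schouten tensor is $A=\operatorname{Ric}-\frac{S}{2(m-1)}g$, the Cotton tensor is $C_{ijk}=A_{ij,k}-A_{ik,j}$, and the Bach tensor is $B_{ij}=\frac{1}{m-2}(C_{jik,k}+R_{kt}W_{ikjt})$. The tensor $D$ is $$D_{ijk}=\frac{1}{m-2}(f_kR_{ij}-f_jR_{ik})+\frac{1}{(m-1)(m-2)}f_t(R_{tk}\delta_{ij}-R_{tj}\delta_{ik})-\frac{S}{(m-1)(m-2)}(f_k\delta_{ij}-f_j\delta_{ik}).$$ *)

theory Defs
  imports "HOL-Analysis.Analysis"
begin

section \<open>Smooth functions on open subsets of Euclidean space\<close>

primrec Ck_on :: "nat \<Rightarrow> (real^'m::finite) set \<Rightarrow> (real^'m \<Rightarrow> real) \<Rightarrow> bool" where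
  "Ck_on 0 S h \<longleftrightarrow> continuous_on S h"
| "Ck_on (Suc k) S h \<longleftrightarrow>
     (\<forall>x\<in>S. h differentiable (at x)) \<and>
     (\<forall>i. Ck_on k S (\<lambda>x. frechet_derivative h (at x) (axis i 1)))"

definition smooth_on :: "(real^'m::finite) set \<Rightarrow> (real^'m \<Rightarrow> real) \<Rightarrow> bool" where
  "smooth_on S h \<longleftrightarrow> (\<forall>k. Ck_on k S h)"


section \<open>Smooth manifolds, tangent vectors and vector fields\<close>

text \<open>
  A tangent vector is a derivation on real functions. A vector field (or a frame field) is a
  function of the base point; only its values on the open set under consideration matter.
\<close>

type_synonym 'a tvec = "('a \<Rightarrow> real) \<Rightarrow> real"
type_synonym 'a vfield = "'a \<Rightarrow> 'a tvec"

text \<open>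
  The dimension is \<^term>\<open>CARD('m)\<close>. An atlas consists of pairs of a coordinate domain and a
  coordinate map. The field \<open>mf_conn\<close> is a connection, \<open>mf_conn M X Y\<close> being the covariant
  derivative of \<open>Y\<close> in direction \<open>X\<close>.
\<close>

record ('a, 'm) rmanifold =
  mf_top :: "'a topology"
  mf_atlas :: "('a set \<times> ('a \<Rightarrow> real^('m::finite))) set"
  mf_metric :: "'a \<Rightarrow> 'a tvec \<Rightarrow> 'a tvec \<Rightarrow> real"
  mf_conn :: "'a vfield \<Rightarrow> 'a vfield \<Rightarrow> 'a vfield"

definition is_chart :: "'a topology \<Rightarrow> 'a set \<Rightarrow> ('a \<Rightarrow> real^'m::finite) \<Rightarrow> bool" where
  "is_chart X U \<phi> \<longleftrightarrow>
     openin X U \<and> open (\<phi> ` U) \<and>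
     homeomorphic_map (subtopology X U) (top_of_set (\<phi> ` U)) \<phi>"

definition smooth_manifold :: "('a, 'm::finite) rmanifold \<Rightarrow> bool" where
  "smooth_manifold M \<longleftrightarrow>
     Hausdorff_space (mf_top M) \<and> second_countable (mf_top M) \<and>
     (\<forall>(U, \<phi>)\<in>mf_atlas M. is_chart (mf_top M) U \<phi>) \<and>
     (\<Union>(U, \<phi>)\<in>mf_atlas M. U) = topspace (mf_top M) \<and>
     (\<forall>(U, \<phi>)\<in>mf_atlas M. \<forall>(V, \<psi>)\<in>mf_atlas M. \<forall>i.
        smooth_on (\<phi> ` (U \<inter> V)) (\<lambda>x. \<psi> (inv_into U \<phi> x) $ i))"

definition smooth_fun :: "('a, 'm::finite) rmanifold \<Rightarrow> 'a set \<Rightarrow> ('a \<Rightarrow> real) \<Rightarrow> bool" where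
  "smooth_fun M W F \<longleftrightarrow>
     (\<forall>(U, \<phi>)\<in>mf_atlas M. smooth_on (\<phi> ` (U \<inter> W)) (\<lambda>x. F (inv_into U \<phi> x)))"

definition smooth_near :: "('a, 'm::finite) rmanifold \<Rightarrow> 'a \<Rightarrow> ('a \<Rightarrow> real) \<Rightarrow> bool" where
  "smooth_near M p F \<longleftrightarrow> (\<exists>W. openin (mf_top M) W \<and> p \<in> W \<and> smooth_fun M W F)"

text \<open>
  Derivations at \<open>p\<close> of the functions that are smooth near \<open>p\<close>. The value on other functions is
  normalised to \<open>0\<close>, so that equality of tangent vectors is equality of functions. (A derivation
  automatically depends on the germ only: if \<open>F\<close> vanishes near \<open>p\<close>, apply the Leibniz rule to the
  product of \<open>F\<close> with the indicator function of the set where \<open>F\<close> is nonzero.)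
\<close>

definition tangent_space :: "('a, 'm::finite) rmanifold \<Rightarrow> 'a \<Rightarrow> 'a tvec set" where
  "tangent_space M p = {v.
     (\<forall>F. \<not> smooth_near M p F \<longrightarrow> v F = 0) \<and>
     (\<forall>F G. smooth_near M p F \<longrightarrow> smooth_near M p G \<longrightarrow>
        v (\<lambda>q. F q + G q) = v F + v G \<and>
        v (\<lambda>q. F q * G q) = v F * G p + F p * v G) \<and>
     (\<forall>c F. smooth_near M p F \<longrightarrow> v (\<lambda>q. c * F q) = c * v F)}"

definition vector_field :: "('a, 'm::finite) rmanifold \<Rightarrow> 'a set \<Rightarrow> 'a vfield \<Rightarrow> bool" where
  "vector_field M W X \<longleftrightarrow>
     (\<forall>p\<in>W. X p \<in> tangent_space M p) \<and>
     (\<forall>V F. openin (mf_top M) V \<longrightarrow> V \<subseteq> W \<longrightarrow> smooth_fun M V F \<longrightarrow>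
        smooth_fun M V (\<lambda>p. X p F))"

definition bracket :: "('a, 'm::finite) rmanifold \<Rightarrow> 'a vfield \<Rightarrow> 'a vfield \<Rightarrow> 'a vfield" where
  "bracket M X Y = (\<lambda>p F. if smooth_near M p F
     then X p (\<lambda>q. Y q F) - Y p (\<lambda>q. X q F) else 0)"


section \<open>Riemannian metric, Levi-Civita connection, curvature\<close>

definition riemannian_metric :: "('a, 'm::finite) rmanifold \<Rightarrow> bool" where
  "riemannian_metric M \<longleftrightarrow>
     (\<forall>p\<in>topspace (mf_top M). \<forall>u\<in>tangent_space M p. \<forall>v\<in>tangent_space M p.
        mf_metric M p u v = mf_metric M p v u \<and>
        (u \<noteq> (\<lambda>F. 0) \<longrightarrow> 0 < mf_metric M p u u) \<and>
        (\<forall>w\<in>tangent_space M p. \<forall>a b.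
           mf_metric M p (\<lambda>F. a * u F + b * v F) w = a * mf_metric M p u w + b * mf_metric M p v w)) \<and>
     (\<forall>W X Y. openin (mf_top M) W \<longrightarrow> vector_field M W X \<longrightarrow> vector_field M W Y \<longrightarrow>
        smooth_fun M W (\<lambda>p. mf_metric M p (X p) (Y p)))"

definition riemannian_manifold :: "('a, 'm::finite) rmanifold \<Rightarrow> bool" where
  "riemannian_manifold M \<longleftrightarrow> smooth_manifold M \<and> riemannian_metric M"

definition affine_connection :: "('a, 'm::finite) rmanifold \<Rightarrow> bool" where
  "affine_connection M \<longleftrightarrow>
     (\<forall>W X Y Z F. openin (mf_top M) W \<longrightarrow> vector_field M W X \<longrightarrow> vector_field M W Y \<longrightarrow>
        vector_field M W Z \<longrightarrow> smooth_fun M W F \<longrightarrow>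
        vector_field M W (mf_conn M X Z) \<and>
        (\<forall>p\<in>W.
          mf_conn M (\<lambda>q G. X q G + Y q G) Z p = (\<lambda>G. mf_conn M X Z p G + mf_conn M Y Z p G) \<and>
          mf_conn M (\<lambda>q G. F q * X q G) Z p = (\<lambda>G. F p * mf_conn M X Z p G) \<and>
          mf_conn M X (\<lambda>q G. Y q G + Z q G) p = (\<lambda>G. mf_conn M X Y p G + mf_conn M X Z p G) \<and>
          mf_conn M X (\<lambda>q G. F q * Z q G) p = (\<lambda>G. X p F * Z p G + F p * mf_conn M X Z p G)))"

text \<open>
  The torsion-free metric connection. The axioms hold on every open set, so on local vector
  fields they determine \<open>mf_conn M\<close> uniquely in terms of the metric; it is a field of the record
  only to serve as a name for this connection.
\<close>

definition levi_civita :: "('a, 'm::finite) rmanifold \<Rightarrow> bool" where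
  "levi_civita M \<longleftrightarrow> affine_connection M \<and>
     (\<forall>W X Y Z. openin (mf_top M) W \<longrightarrow> vector_field M W X \<longrightarrow> vector_field M W Y \<longrightarrow>
        vector_field M W Z \<longrightarrow>
        (\<forall>p\<in>W.
          (\<lambda>G. mf_conn M X Y p G - mf_conn M Y X p G) = bracket M X Y p \<and>
          X p (\<lambda>q. mf_metric M q (Y q) (Z q)) =
            mf_metric M p (mf_conn M X Y p) (Z p) + mf_metric M p (Y p) (mf_conn M X Z p)))"

definition curvature ::
  "('a, 'm::finite) rmanifold \<Rightarrow> 'a vfield \<Rightarrow> 'a vfield \<Rightarrow> 'a vfield \<Rightarrow> 'a vfield" where
  "curvature M X Y Z = (\<lambda>p G.
     mf_conn M X (mf_conn M Y Z) p G - mf_conn M Y (mf_conn M X Z) p G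
     - mf_conn M (bracket M X Y) Z p G)"


section \<open>Components in a local orthonormal frame\<close>

type_synonym ('a, 'm) frame = "'m \<Rightarrow> 'a vfield"

abbreviation kd :: "'m \<Rightarrow> 'm \<Rightarrow> real" where
  "kd i j \<equiv> (if i = j then 1 else 0)"

definition orthonormal_frame ::
  "('a, 'm::finite) rmanifold \<Rightarrow> 'a set \<Rightarrow> ('a, 'm) frame \<Rightarrow> bool" where
  "orthonormal_frame M W E \<longleftrightarrow>
     openin (mf_top M) W \<and> (\<forall>i. vector_field M W (E i)) \<and>
     (\<forall>p\<in>W.
        (\<forall>i j. mf_metric M p (E i p) (E j p) = kd i j) \<and>
        (\<forall>v\<in>tangent_space M p. \<exists>c. v = (\<lambda>F. \<Sum>i\<in>UNIV. c i * E i p F)))"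

text \<open>The coefficient along \<open>E l\<close> of the covariant derivative of \<open>E i\<close> in direction \<open>E k\<close>.\<close>

definition conn_coeff ::
  "('a, 'm::finite) rmanifold \<Rightarrow> ('a, 'm) frame \<Rightarrow> 'm \<Rightarrow> 'm \<Rightarrow> 'm \<Rightarrow> 'a \<Rightarrow> real" where
  "conn_coeff M E k i l p = mf_metric M p (mf_conn M (E k) (E i) p) (E l p)"

text \<open>
  Components of the covariant derivative of covariant tensors of rank 1, 2, 3 given by their
  components \<open>T\<close>. The differentiation index is the last one, as in the comma notation: \<open>cov2 M E T i j k\<close>
  is \<open>T\<^sub>i\<^sub>j\<^sub>,\<^sub>k\<close>.
\<close>

definition cov1 :: "('a, 'm::finite) rmanifold \<Rightarrow> ('a, 'm) frame \<Rightarrow> ('m \<Rightarrow> 'a \<Rightarrow> real) \<Rightarrow>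
    'm \<Rightarrow> 'm \<Rightarrow> 'a \<Rightarrow> real" where
  "cov1 M E T i k p = E k p (T i) - (\<Sum>l\<in>UNIV. conn_coeff M E k i l p * T l p)"

definition cov2 :: "('a, 'm::finite) rmanifold \<Rightarrow> ('a, 'm) frame \<Rightarrow> ('m \<Rightarrow> 'm \<Rightarrow> 'a \<Rightarrow> real) \<Rightarrow>
    'm \<Rightarrow> 'm \<Rightarrow> 'm \<Rightarrow> 'a \<Rightarrow> real" where
  "cov2 M E T i j k p = E k p (T i j)
     - (\<Sum>l\<in>UNIV. conn_coeff M E k i l p * T l j p)
     - (\<Sum>l\<in>UNIV. conn_coeff M E k j l p * T i l p)"

definition cov3 :: "('a, 'm::finite) rmanifold \<Rightarrow> ('a, 'm) frame \<Rightarrow>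
    ('m \<Rightarrow> 'm \<Rightarrow> 'm \<Rightarrow> 'a \<Rightarrow> real) \<Rightarrow> 'm \<Rightarrow> 'm \<Rightarrow> 'm \<Rightarrow> 'm \<Rightarrow> 'a \<Rightarrow> real" where
  "cov3 M E T i j h k p = E k p (T i j h)
     - (\<Sum>l\<in>UNIV. conn_coeff M E k i l p * T l j h p)
     - (\<Sum>l\<in>UNIV. conn_coeff M E k j l p * T i l h p)
     - (\<Sum>l\<in>UNIV. conn_coeff M E k h l p * T i j l p)"

definition dfun :: "('a, 'm::finite) frame \<Rightarrow> ('a \<Rightarrow> real) \<Rightarrow> 'm \<Rightarrow> 'a \<Rightarrow> real" where
  "dfun E f i p = E i p f"

definition hess :: "('a, 'm::finite) rmanifold \<Rightarrow> ('a, 'm) frame \<Rightarrow> ('a \<Rightarrow> real) \<Rightarrow>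
    'm \<Rightarrow> 'm \<Rightarrow> 'a \<Rightarrow> real" where
  "hess M E f = cov1 M E (dfun E f)"

text \<open>
  Sign convention: with this order of arguments the Ricci identity reads
  \<open>f\<^sub>i\<^sub>j\<^sub>k = f\<^sub>i\<^sub>k\<^sub>j + f\<^sub>t R\<^sub>t\<^sub>i\<^sub>j\<^sub>k\<close>, and the Ricci tensor of a round sphere is positive.
\<close>

definition riem :: "('a, 'm::finite) rmanifold \<Rightarrow> ('a, 'm) frame \<Rightarrow>
    'm \<Rightarrow> 'm \<Rightarrow> 'm \<Rightarrow> 'm \<Rightarrow> 'a \<Rightarrow> real" where
  "riem M E i j k t p = mf_metric M p (curvature M (E k) (E t) (E j) p) (E i p)"

definition ric :: "('a, 'm::finite) rmanifold \<Rightarrow> ('a, 'm) frame \<Rightarrow> 'm \<Rightarrow> 'm \<Rightarrow> 'a \<Rightarrow> real" where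
  "ric M E i j p = (\<Sum>t\<in>UNIV. riem M E i t j t p)"

definition scal :: "('a, 'm::finite) rmanifold \<Rightarrow> ('a, 'm) frame \<Rightarrow> 'a \<Rightarrow> real" where
  "scal M E p = (\<Sum>t\<in>UNIV. ric M E t t p)"

definition weyl :: "('a, 'm::finite) rmanifold \<Rightarrow> ('a, 'm) frame \<Rightarrow>
    'm \<Rightarrow> 'm \<Rightarrow> 'm \<Rightarrow> 'm \<Rightarrow> 'a \<Rightarrow> real" where
  "weyl M E i j k t p = (let m = real CARD('m) in
     riem M E i j k t p
     - 1 / (m - 2) * (ric M E i k p * kd j t - ric M E i t p * kd j k
                      + ric M E j t p * kd i k - ric M E j k p * kd i t)
     + scal M E p / ((m - 1) * (m - 2)) * (kd i k * kd j t - kd i t * kd j k))"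

definition schouten :: "('a, 'm::finite) rmanifold \<Rightarrow> ('a, 'm) frame \<Rightarrow> 'm \<Rightarrow> 'm \<Rightarrow> 'a \<Rightarrow> real" where
  "schouten M E i j p = ric M E i j p - scal M E p / (2 * (real CARD('m) - 1)) * kd i j"

definition cotton :: "('a, 'm::finite) rmanifold \<Rightarrow> ('a, 'm) frame \<Rightarrow>
    'm \<Rightarrow> 'm \<Rightarrow> 'm \<Rightarrow> 'a \<Rightarrow> real" where
  "cotton M E i j k p = cov2 M E (schouten M E) i j k p - cov2 M E (schouten M E) i k j p"

definition bach :: "('a, 'm::finite) rmanifold \<Rightarrow> ('a, 'm) frame \<Rightarrow> 'm \<Rightarrow> 'm \<Rightarrow> 'a \<Rightarrow> real" where
  "bach M E i j p = 1 / (real CARD('m) - 2) *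
     ((\<Sum>k\<in>UNIV. cov3 M E (cotton M E) j i k k p)
      + (\<Sum>k\<in>UNIV. \<Sum>t\<in>UNIV. ric M E k t p * weyl M E i k j t p))"

definition dtensor :: "('a, 'm::finite) rmanifold \<Rightarrow> ('a, 'm) frame \<Rightarrow> ('a \<Rightarrow> real) \<Rightarrow>
    'm \<Rightarrow> 'm \<Rightarrow> 'm \<Rightarrow> 'a \<Rightarrow> real" where
  "dtensor M E f i j k p = (let m = real CARD('m) in
     1 / (m - 2) * (dfun E f k p * ric M E i j p - dfun E f j p * ric M E i k p)
     + 1 / ((m - 1) * (m - 2)) *
         (\<Sum>t\<in>UNIV. dfun E f t p * (ric M E t k p * kd i j - ric M E t j p * kd i k))
     - scal M E p / ((m - 1) * (m - 2)) * (dfun E f k p * kd i j - dfun E f j p * kd i k))"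


section \<open>Gradient Einstein-type manifolds\<close>

text \<open>The tensor equation on the manifold, in components in every local orthonormal frame.\<close>

definition gradient_einstein_type :: "('a, 'm::finite) rmanifold \<Rightarrow> ('a \<Rightarrow> real) \<Rightarrow> ('a \<Rightarrow> real) \<Rightarrow>
    real \<Rightarrow> real \<Rightarrow> real \<Rightarrow> real \<Rightarrow> bool" where
  "gradient_einstein_type M f lam \<alpha> \<beta> \<mu> \<rho> \<longleftrightarrow>
     smooth_fun M (topspace (mf_top M)) f \<and> smooth_fun M (topspace (mf_top M)) lam \<and>
     (\<alpha>, \<beta>, \<mu>) \<noteq> (0, 0, 0) \<and>
     (\<forall>W E. orthonormal_frame M W E \<longrightarrow> (\<forall>p\<in>W. \<forall>i j.
        \<alpha> * ric M E i j p + \<beta> * hess M E f i j p + \<mu> * (dfun E f i p * dfun E f j p)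
          = (\<rho> * scal M E p + lam p) * kd i j))"

end

theory Submission
  imports Defs
begin

text \<open>
  Differentiating the Einstein-type equation covariantly, skew-symmetrising in the last two indices
  and applying the Ricci identity to the derivatives of \<open>f\<close> expresses the Cotton tensor through
  \<open>f\<^sub>t R\<^sub>t\<^sub>i\<^sub>j\<^sub>k\<close>, products of \<open>df\<close> and the Hessian, and an unknown one-form times the metric. The
  trace of this equation determines the one-form, because the Cotton tensor is trace-free by the
  contracted second Bianchi identity; substituting the equation itself for the Hessian gives the
  first condition. The second condition is the divergence of the first one: the divergence of the
  Weyl tensor is a multiple of the Cotton tensor, and the divergence of the Cotton tensor is
  symmetric. The curvature identities all follow from the expression of the curvature in terms of
  the connection coefficients in the frame.
\<close>

section \<open>Smooth functions on a manifold\<close>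

text \<open>All identities concern components in one arbitrary orthonormal frame on
  \<open>W\<close>; no frame adapted to the point is chosen. Derivations and the connection take
  functions and fields on the whole carrier, while the formulas hold on \<open>W\<close> only, so
  substituting under a derivative needs locality. Once the curvature is expressed in the frame,
  metric compatibility enters only as skew-symmetry of the connection coefficients. The factor of D
  has two sources. Replacing the Riemann by the Weyl tensor leaves, with its share of the trace
  term, \<beta> D. The Hessian in the \<mu> terms contributes -(\<alpha> \<mu> / \<beta>) (f_k R_ij
  - f_j R_ik), which with its trace part is -(m-2) (\<alpha> \<mu> / \<beta>) D. In the divergence,
  the product rule contracts the Hessian with W. By the equation this yields the Ricci-Weyl term of
  the Bach tensor, the \<mu> term and a metric part, zero because W is trace-free. The Bach tensor
  takes the Cotton divergence with the first two indices exchanged, hence the need for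
  symmetry.\<close>

lemma frechet_derivative_transform_open:
  assumes "open S" "x \<in> S" "\<And>y. y \<in> S \<Longrightarrow> f y = g y"
  shows "frechet_derivative f (at x) = frechet_derivative g (at x)"
proof -
  have "(f has_derivative d) (at x) \<longleftrightarrow> (g has_derivative d) (at x)" for d
    using assms has_derivative_transform_within_open[of f d x UNIV S g]
      has_derivative_transform_within_open[of g d x UNIV S f] by auto
  then show ?thesis
    by (simp add: frechet_derivative_def)
qed

text \<open>\<open>Ck_on\<close> takes full derivatives at the points of \<open>S\<close>, so values
  outside \<open>S\<close> could matter; openness keeps them out.\<close>

lemma Ck_on_cong:
  assumes "open S" "\<And>y. y \<in> S \<Longrightarrow> f y = g y" "Ck_on k S f"
  shows "Ck_on k S g"
  using assms(2,3)
proof (induction k arbitrary: f g)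
  case 0
  then show ?case using continuous_on_cong[of S S f g] by simp
next
  case (Suc k)
  have "g differentiable (at x)" if x: "x \<in> S" for x
  proof -
    from Suc.prems x obtain d where "(f has_derivative d) (at x)"
      by (auto simp: differentiable_def)
    then have "(g has_derivative d) (at x)"
      using assms(1) x Suc.prems(1) has_derivative_transform_within_open by blast
    then show ?thesis by (auto simp: differentiable_def)
  qed
  moreover have "Ck_on k S (\<lambda>x. frechet_derivative g (at x) (axis i 1))" for i
  proof (rule Suc.IH)
    show "Ck_on k S (\<lambda>x. frechet_derivative f (at x) (axis i 1))"
      using Suc.prems by simp
    show "frechet_derivative f (at x) (axis i 1) = frechet_derivative g (at x) (axis i 1)"
      if "x \<in> S" for x
      using frechet_derivative_transform_open[OF assms(1) that, of f g] Suc.prems(1) by simp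
  qed
  ultimately show ?case by simp
qed

lemma Ck_on_subset: "Ck_on k S f \<Longrightarrow> T \<subseteq> S \<Longrightarrow> Ck_on k T f"
  by (induction k arbitrary: f) (auto intro: continuous_on_subset)

text \<open>The product rule pairs a derivative with an undifferentiated factor, whose order must be
  lowered to match in the induction for \<open>Ck_on_mult\<close>.\<close>

lemma Ck_on_SucD: "Ck_on (Suc k) S f \<Longrightarrow> Ck_on k S f"
proof (induction k arbitrary: f)
  case 0
  then have "continuous (at x within S) f" if "x \<in> S" for x
    using that differentiable_imp_continuous_within[of f x UNIV]
    by (auto intro: continuous_within_subset[of x UNIV])
  then show ?case by (simp add: continuous_on_eq_continuous_within)
next
  case (Suc k)
  show ?case
    unfolding Ck_on.simps(2)[of k]
    using Suc.prems Suc.IH[OF spec[OF conjunct2[OF Suc.prems[unfolded Ck_on.simps(2)[of "Suc k"]]]]]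
    by simp
qed

lemma Ck_on_const: "Ck_on k S (\<lambda>x. c)"
  by (induction k arbitrary: c) (auto simp: frechet_derivative_const)

lemma Ck_on_add:
  assumes "open S"
  shows "Ck_on k S f \<Longrightarrow> Ck_on k S g \<Longrightarrow> Ck_on k S (\<lambda>x. f x + g x)"
proof (induction k arbitrary: f g)
  case 0
  then show ?case by (auto intro: continuous_on_add)
next
  case (Suc k)
  have "Ck_on k S (\<lambda>x. frechet_derivative (\<lambda>x. f x + g x) (at x) (axis i 1))" for i
  proof (rule Ck_on_cong[OF assms])
    show "Ck_on k S (\<lambda>x. frechet_derivative f (at x) (axis i 1)
        + frechet_derivative g (at x) (axis i 1))"
      using Suc by simp
    show "frechet_derivative f (at x) (axis i 1) + frechet_derivative g (at x) (axis i 1)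
        = frechet_derivative (\<lambda>x. f x + g x) (at x) (axis i 1)" if "x \<in> S" for x
    proof -
      have "(f has_derivative frechet_derivative f (at x)) (at x)"
        "(g has_derivative frechet_derivative g (at x)) (at x)"
        using Suc.prems that by (simp_all add: frechet_derivative_works[symmetric])
      from has_derivative_add[OF this] show ?thesis
        by (simp add: frechet_derivative_at[symmetric])
    qed
  qed
  then show ?case using Suc.prems by (auto intro: differentiable_add)
qed

lemma Ck_on_mult:
  assumes "open S"
  shows "Ck_on k S f \<Longrightarrow> Ck_on k S g \<Longrightarrow> Ck_on k S (\<lambda>x. f x * g x)"
proof (induction k arbitrary: f g)
  case 0
  then show ?case by (auto intro: continuous_on_mult)
next
  case (Suc k)
  have "Ck_on k S (\<lambda>x. frechet_derivative (\<lambda>x. f x * g x) (at x) (axis i 1))" for i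
  proof (rule Ck_on_cong[OF assms])
    show "Ck_on k S (\<lambda>x. f x * frechet_derivative g (at x) (axis i 1)
        + frechet_derivative f (at x) (axis i 1) * g x)"
      using Suc.IH Suc.prems Ck_on_SucD[OF Suc.prems(1)] Ck_on_SucD[OF Suc.prems(2)]
      by (intro Ck_on_add assms Suc.IH) auto
    show "f x * frechet_derivative g (at x) (axis i 1)
        + frechet_derivative f (at x) (axis i 1) * g x
        = frechet_derivative (\<lambda>x. f x * g x) (at x) (axis i 1)" if "x \<in> S" for x
    proof -
      have "(f has_derivative frechet_derivative f (at x)) (at x)"
        "(g has_derivative frechet_derivative g (at x)) (at x)"
        using Suc.prems that by (simp_all add: frechet_derivative_works[symmetric])
      from has_derivative_mult[OF this] show ?thesis
        by (simp add: frechet_derivative_at[symmetric])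
    qed
  qed
  then show ?case using Suc.prems by (auto intro: differentiable_mult)
qed

section \<open>Smooth functions seen through charts\<close>

lemma chart_image_open:
  assumes "smooth_manifold M" "(U, \<phi>) \<in> mf_atlas M" "openin (mf_top M) W"
  shows "open (\<phi> ` (U \<inter> W))"
proof -
  have c: "is_chart (mf_top M) U \<phi>"
    using assms by (auto simp: smooth_manifold_def)
  then have "open_map (subtopology (mf_top M) U) (top_of_set (\<phi> ` U)) \<phi>"
    by (auto simp: is_chart_def homeomorphic_imp_open_map)
  moreover have "openin (subtopology (mf_top M) U) (U \<inter> W)"
    using assms(3) by (auto simp: openin_subtopology)
  ultimately have "openin (top_of_set (\<phi> ` U)) (\<phi> ` (U \<inter> W))"
    by (auto simp: open_map_def)
  then show ?thesis
    using c openin_open_trans by (auto simp: is_chart_def)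
qed

lemma chart_inj:
  assumes "smooth_manifold M" "(U, \<phi>) \<in> mf_atlas M"
  shows "inj_on \<phi> U"
proof -
  have c: "is_chart (mf_top M) U \<phi>"
    using assms by (auto simp: smooth_manifold_def)
  then have "U \<subseteq> topspace (mf_top M)"
    by (auto simp: is_chart_def dest: openin_subset)
  with c show ?thesis
    by (auto simp: is_chart_def homeomorphic_eq_everything_map Int_absorb1)
qed

lemma smooth_fun_cong:
  assumes "smooth_manifold M" "openin (mf_top M) W" "smooth_fun M W F"
    and "\<And>q. q \<in> W \<Longrightarrow> F q = F' q"
  shows "smooth_fun M W F'"
  unfolding smooth_fun_def
proof (clarify)
  fix U \<phi> assume U: "(U, \<phi>) \<in> mf_atlas M"
  have "inv_into U \<phi> x \<in> W" if "x \<in> \<phi> ` (U \<inter> W)" for x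
    using that chart_inj[OF assms(1) U] by auto
  then have "Ck_on k (\<phi> ` (U \<inter> W)) (\<lambda>x. F' (inv_into U \<phi> x))"
    if "Ck_on k (\<phi> ` (U \<inter> W)) (\<lambda>x. F (inv_into U \<phi> x))" for k
    by (intro Ck_on_cong[OF chart_image_open[OF assms(1) U assms(2)] _ that] assms(4))
  moreover have "smooth_on (\<phi> ` (U \<inter> W)) (\<lambda>x. F (inv_into U \<phi> x))"
    using assms(3) U by (auto simp: smooth_fun_def)
  ultimately show "smooth_on (\<phi> ` (U \<inter> W)) (\<lambda>x. F' (inv_into U \<phi> x))"
    unfolding smooth_on_def by blast
qed

lemma smooth_fun_subset: "smooth_fun M W F \<Longrightarrow> V \<subseteq> W \<Longrightarrow> smooth_fun M V F"
  unfolding smooth_fun_def smooth_on_def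
  using Ck_on_subset[OF _ image_mono[OF Int_mono[OF order_refl]]] by blast

lemma smooth_fun_const: "smooth_fun M W (\<lambda>q. c)"
  by (auto simp: smooth_fun_def smooth_on_def Ck_on_const)

lemma smooth_fun_add:
  assumes "smooth_manifold M" "openin (mf_top M) W" "smooth_fun M W F" "smooth_fun M W G"
  shows "smooth_fun M W (\<lambda>q. F q + G q)"
  unfolding smooth_fun_def smooth_on_def
proof (clarify)
  fix U \<phi> k assume U: "(U, \<phi>) \<in> mf_atlas M"
  then have "Ck_on k (\<phi> ` (U \<inter> W)) (\<lambda>x. F (inv_into U \<phi> x))"
    "Ck_on k (\<phi> ` (U \<inter> W)) (\<lambda>x. G (inv_into U \<phi> x))"
    using assms(3,4) by (auto simp: smooth_fun_def smooth_on_def)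
  then show "Ck_on k (\<phi> ` (U \<inter> W)) (\<lambda>x. F (inv_into U \<phi> x) + G (inv_into U \<phi> x))"
    by (rule Ck_on_add[OF chart_image_open[OF assms(1) U assms(2)]])
qed

lemma smooth_fun_mult:
  assumes "smooth_manifold M" "openin (mf_top M) W" "smooth_fun M W F" "smooth_fun M W G"
  shows "smooth_fun M W (\<lambda>q. F q * G q)"
  unfolding smooth_fun_def smooth_on_def
proof (clarify)
  fix U \<phi> k assume U: "(U, \<phi>) \<in> mf_atlas M"
  then have "Ck_on k (\<phi> ` (U \<inter> W)) (\<lambda>x. F (inv_into U \<phi> x))"
    "Ck_on k (\<phi> ` (U \<inter> W)) (\<lambda>x. G (inv_into U \<phi> x))"
    using assms(3,4) by (auto simp: smooth_fun_def smooth_on_def)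
  then show "Ck_on k (\<phi> ` (U \<inter> W)) (\<lambda>x. F (inv_into U \<phi> x) * G (inv_into U \<phi> x))"
    by (rule Ck_on_mult[OF chart_image_open[OF assms(1) U assms(2)]])
qed

section \<open>Vector fields and orthonormal frames\<close>

lemma tangent_spaceD:
  assumes "v \<in> tangent_space M p"
  shows "\<not> smooth_near M p F \<Longrightarrow> v F = 0"
    and "smooth_near M p F \<Longrightarrow> smooth_near M p G \<Longrightarrow> v (\<lambda>q. F q + G q) = v F + v G"
    and "smooth_near M p F \<Longrightarrow> smooth_near M p G \<Longrightarrow> v (\<lambda>q. F q * G q) = v F * G p + F p * v G"
    and "smooth_near M p F \<Longrightarrow> v (\<lambda>q. c * F q) = c * v F"
  using assms by (auto simp: tangent_space_def)

lemma tangent_space_lincomb: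
  "u \<in> tangent_space M p \<Longrightarrow> v \<in> tangent_space M p \<Longrightarrow>
    (\<lambda>F. a * u F + b * v F) \<in> tangent_space M p"
  unfolding tangent_space_def by (auto simp: algebra_simps)

lemma tangent_space_zero: "(\<lambda>F. 0) \<in> tangent_space M p"
  unfolding tangent_space_def by auto

lemma tangent_space_sum:
  assumes "finite I" "\<And>i. i \<in> I \<Longrightarrow> u i \<in> tangent_space M p"
  shows "(\<lambda>F. \<Sum>i\<in>I. c i * u i F) \<in> tangent_space M p"
  using assms
proof (induction I rule: finite_induct)
  case empty
  then show ?case by (simp add: tangent_space_zero)
next
  case (insert i I)
  then show ?case
    using tangent_space_lincomb[of "u i" M p "\<lambda>F. \<Sum>i\<in>I. c i * u i F" "c i" 1] by simp
qed

lemma smooth_nearI: "openin (mf_top M) W \<Longrightarrow> smooth_fun M W F \<Longrightarrow> p \<in> W \<Longrightarrow> smooth_near M p F"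
  by (auto simp: smooth_near_def)

lemma tangent_const:
  assumes "v \<in> tangent_space M p" "openin (mf_top M) W" "p \<in> W"
  shows "v (\<lambda>q. c) = 0"
proof -
  have s: "smooth_near M p (\<lambda>q. c)" for c
    by (rule smooth_nearI[OF assms(2) smooth_fun_const assms(3)])
  have "v (\<lambda>q. 1 * 1) = v (\<lambda>q. 1) * 1 + 1 * v (\<lambda>q. 1)"
    using tangent_spaceD(3)[OF assms(1) s s, of 1 1] by simp
  then have "v (\<lambda>q. 1) = 0" by simp
  then show ?thesis
    using tangent_spaceD(4)[OF assms(1) s, of c 1] by simp
qed

text \<open>The function vanishes near the point, so it is its own product with the indicator function
  of its support, and both factors vanish at the point.\<close>

lemma tangent_local:
  assumes M: "smooth_manifold M" and W: "openin (mf_top M) W" and p: "p \<in> W"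
    and v: "v \<in> tangent_space M p" and F: "smooth_fun M W F"
    and eq: "\<And>q. q \<in> W \<Longrightarrow> F q = F' q"
  shows "v F = v F'"
proof -
  have F': "smooth_fun M W F'"
    by (rule smooth_fun_cong[OF M W F eq])
  define H where "H q = F q + (-1) * F' q" for q
  define chi where "chi q = (if H q = 0 then 0 else 1::real)" for q
  have "smooth_fun M W H" "smooth_fun M W chi"
    by (rule smooth_fun_cong[OF M W smooth_fun_const[of M W 0]]; simp add: H_def chi_def eq)+
  note s = this[THEN smooth_nearI[OF W _ p]]
  have "v H = v (\<lambda>q. H q * chi q)"
    by (rule arg_cong[where f = v]) (simp add: chi_def fun_eq_iff)
  also have "\<dots> = v H * chi p + H p * v chi"
    by (rule tangent_spaceD(3)[OF v s])
  also have "\<dots> = 0"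
    using eq[OF p] by (simp add: H_def chi_def)
  finally have "v H = 0" .
  moreover have "v H = v F + (-1) * v F'"
    unfolding H_def[abs_def]
    using tangent_spaceD(2)[OF v, of F "\<lambda>q. (-1) * F' q"] tangent_spaceD(4)[OF v, of F' "-1"]
      smooth_nearI[OF W F p] smooth_nearI[OF W F' p]
      smooth_nearI[OF W smooth_fun_mult[OF M W smooth_fun_const F'] p, of "-1"]
    by metis
  ultimately show ?thesis by simp
qed

lemma vector_field_subset: "vector_field M W X \<Longrightarrow> V \<subseteq> W \<Longrightarrow> vector_field M V X"
  unfolding vector_field_def by (meson order_trans subsetD)

lemma vector_field_cong:
  assumes "smooth_manifold M" "vector_field M W X" "\<And>q. q \<in> W \<Longrightarrow> X q = Y q"
  shows "vector_field M W Y"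
  unfolding vector_field_def
proof (intro conjI ballI allI impI)
  show "Y p \<in> tangent_space M p" if "p \<in> W" for p
    using assms(2,3) that by (auto simp: vector_field_def)
  fix V F assume V: "openin (mf_top M) V" "V \<subseteq> W" "smooth_fun M V F"
  then have "smooth_fun M V (\<lambda>p. X p F)"
    using assms(2) by (auto simp: vector_field_def)
  then show "smooth_fun M V (\<lambda>p. Y p F)"
    by (rule smooth_fun_cong[OF assms(1) V(1)]) (use V(2) assms(3) in auto)
qed

lemma vector_field_zero: "vector_field M W (\<lambda>q G. 0)"
  by (auto simp: vector_field_def tangent_space_zero smooth_fun_const)

lemma vector_field_add:
  assumes "smooth_manifold M" "vector_field M W X" "vector_field M W Y"
  shows "vector_field M W (\<lambda>q G. X q G + Y q G)"
  using assms(2,3) tangent_space_lincomb[of _ M _ _ 1 1]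
  by (auto simp: vector_field_def intro!: smooth_fun_add[OF assms(1)])

lemma vector_field_mult:
  assumes "smooth_manifold M" "vector_field M W X" "smooth_fun M W F"
  shows "vector_field M W (\<lambda>q G. F q * X q G)"
  using assms(2,3) tangent_space_lincomb[of _ M _ "\<lambda>F. 0" _ 0]
  by (auto simp: vector_field_def tangent_space_zero intro!: smooth_fun_mult[OF assms(1)]
      intro: smooth_fun_subset)

lemma vector_field_sum:
  assumes "smooth_manifold M" "finite I" "\<And>i. i \<in> I \<Longrightarrow> vector_field M W (X i)"
    "\<And>i. i \<in> I \<Longrightarrow> smooth_fun M W (c i)"
  shows "vector_field M W (\<lambda>q G. \<Sum>i\<in>I. c i q * X i q G)"
  using assms(2-4)
proof (induction I rule: finite_induct)
  case empty
  then show ?case by (simp add: vector_field_zero)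
next
  case (insert i I)
  then show ?case
    using vector_field_add[OF assms(1) vector_field_mult[OF assms(1), of W "X i" "c i"],
        of "\<lambda>q G. \<Sum>i\<in>I. c i q * X i q G"] by simp
qed

section \<open>Derivatives and inner products in a fixed orthonormal frame\<close>

locale ortho_frame =
  fixes M :: "('a, 'm::finite) rmanifold" and W :: "'a set" and E :: "('a, 'm) frame"
  assumes riem_mf: "riemannian_manifold M" and lc: "levi_civita M"
    and frame: "orthonormal_frame M W E"
begin

abbreviation sm :: "('a \<Rightarrow> real) \<Rightarrow> bool" where "sm \<equiv> smooth_fun M W"
abbreviation vf :: "'a vfield \<Rightarrow> bool" where "vf \<equiv> vector_field M W"
abbreviation g :: "'a \<Rightarrow> 'a tvec \<Rightarrow> 'a tvec \<Rightarrow> real" where "g \<equiv> mf_metric M"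
abbreviation T :: "'a \<Rightarrow> 'a tvec set" where "T \<equiv> tangent_space M"
abbreviation \<Gamma> :: "'m \<Rightarrow> 'm \<Rightarrow> 'm \<Rightarrow> 'a \<Rightarrow> real" where "\<Gamma> \<equiv> conn_coeff M E"

lemma smooth_mf: "smooth_manifold M"
  using riem_mf by (simp add: riemannian_manifold_def)

lemma openW: "openin (mf_top M) W"
  using frame by (simp add: orthonormal_frame_def)

lemma W_topspace: "p \<in> W \<Longrightarrow> p \<in> topspace (mf_top M)"
  using openW openin_subset by blast

lemma sm_cong: "sm F \<Longrightarrow> (\<And>q. q \<in> W \<Longrightarrow> F q = G q) \<Longrightarrow> sm G"
  by (rule smooth_fun_cong[OF smooth_mf openW])

lemma sm_const [intro!]: "sm (\<lambda>q. c)"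
  by (rule smooth_fun_const)

lemma sm_add [intro!]: "sm F \<Longrightarrow> sm G \<Longrightarrow> sm (\<lambda>q. F q + G q)"
  by (rule smooth_fun_add[OF smooth_mf openW])

lemma sm_mult [intro!]: "sm F \<Longrightarrow> sm G \<Longrightarrow> sm (\<lambda>q. F q * G q)"
  by (rule smooth_fun_mult[OF smooth_mf openW])

lemma sm_diff [intro!]: "sm F \<Longrightarrow> sm G \<Longrightarrow> sm (\<lambda>q. F q - G q)"
  using sm_add[OF _ sm_mult[OF sm_const[of "-1"]], of F G] by simp

lemma sm_uminus [intro!]: "sm F \<Longrightarrow> sm (\<lambda>q. - F q)"
  using sm_mult[OF sm_const[of "-1"], of F] by simp

lemma sm_divide [intro!]: "sm F \<Longrightarrow> sm (\<lambda>q. F q / c)"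
  using sm_mult[OF _ sm_const[of "inverse c"], of F] by (simp add: divide_inverse)

lemma sm_sum [intro!]: "(\<And>i. i \<in> I \<Longrightarrow> sm (F i)) \<Longrightarrow> sm (\<lambda>q. \<Sum>i\<in>I. F i q)"
proof (induction I rule: infinite_finite_induct)
  case (insert i I)
  then show ?case by auto
qed auto

lemma vfE: "vf (E i)"
  using frame by (simp add: orthonormal_frame_def)

lemma vfT: "vf X \<Longrightarrow> p \<in> W \<Longrightarrow> X p \<in> T p"
  by (auto simp: vector_field_def)

lemma sm_D [intro!]: "sm F \<Longrightarrow> sm (\<lambda>p. E i p F)"
  using vfE[of i] openW by (auto simp: vector_field_def)

lemma sm_metric: "vf X \<Longrightarrow> vf Y \<Longrightarrow> sm (\<lambda>p. g p (X p) (Y p))"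
  using riem_mf openW by (auto simp: riemannian_manifold_def riemannian_metric_def)

lemma ET: "p \<in> W \<Longrightarrow> E i p \<in> T p"
  using vfE vfT by blast

lemma sm_near: "sm F \<Longrightarrow> p \<in> W \<Longrightarrow> smooth_near M p F"
  by (rule smooth_nearI[OF openW])

context
  fixes p assumes p: "p \<in> W"
begin

lemma D_cong: "sm F \<Longrightarrow> (\<And>q. q \<in> W \<Longrightarrow> F q = G q) \<Longrightarrow> E k p F = E k p G"
  by (rule tangent_local[OF smooth_mf openW p ET[OF p]])

lemma D_const: "E k p (\<lambda>q. c) = 0"
  by (rule tangent_const[OF ET[OF p] openW p])

lemma D_add: "sm F \<Longrightarrow> sm G \<Longrightarrow> E k p (\<lambda>q. F q + G q) = E k p F + E k p G"
  using tangent_spaceD(2)[OF ET[OF p]] sm_near[OF _ p] by blast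

lemma D_mult: "sm F \<Longrightarrow> sm G \<Longrightarrow> E k p (\<lambda>q. F q * G q) = E k p F * G p + F p * E k p G"
  using tangent_spaceD(3)[OF ET[OF p]] sm_near[OF _ p] by blast

lemma D_cmult: "sm F \<Longrightarrow> E k p (\<lambda>q. c * F q) = c * E k p F"
  using tangent_spaceD(4)[OF ET[OF p]] sm_near[OF _ p] by blast

lemma D_diff: "sm F \<Longrightarrow> sm G \<Longrightarrow> E k p (\<lambda>q. F q - G q) = E k p F - E k p G"
  using D_add[of F "\<lambda>q. (-1) * G q" k] D_cmult[of G k "-1"] by auto

lemma D_sum: "(\<And>i. i \<in> I \<Longrightarrow> sm (F i)) \<Longrightarrow> E k p (\<lambda>q. \<Sum>i\<in>I. F i q) = (\<Sum>i\<in>I. E k p (F i))"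
proof (induction I rule: infinite_finite_induct)
  case (insert i I)
  then show ?case by (simp add: D_add sm_sum)
qed (auto simp: D_const)

lemma g_sym: "u \<in> T p \<Longrightarrow> v \<in> T p \<Longrightarrow> g p u v = g p v u"
  using riem_mf W_topspace[OF p] by (auto simp: riemannian_manifold_def riemannian_metric_def)

lemma g_lin: "u \<in> T p \<Longrightarrow> v \<in> T p \<Longrightarrow> w \<in> T p \<Longrightarrow>
    g p (\<lambda>F. a * u F + b * v F) w = a * g p u w + b * g p v w"
  using riem_mf W_topspace[OF p] by (auto simp: riemannian_manifold_def riemannian_metric_def)

lemma g_zero: "w \<in> T p \<Longrightarrow> g p (\<lambda>F. 0) w = 0"
  using g_lin[of w w w 0 0] by simp

lemma g_sum:
  assumes "finite I" "\<And>i. i \<in> I \<Longrightarrow> u i \<in> T p" "w \<in> T p"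
  shows "g p (\<lambda>F. \<Sum>i\<in>I. c i * u i F) w = (\<Sum>i\<in>I. c i * g p (u i) w)"
  using assms(1,2)
proof (induction I rule: finite_induct)
  case empty
  then show ?case by (simp add: g_zero assms(3))
next
  case (insert i I)
  then show ?case
    using g_lin[of "u i" "\<lambda>F. \<Sum>i\<in>I. c i * u i F" w "c i" 1] assms(3)
      tangent_space_sum[of I u M p c] by simp
qed

lemma g_EE: "g p (E i p) (E j p) = kd i j"
  using frame p by (auto simp: orthonormal_frame_def)

lemma g_sum_E: "g p (\<lambda>F. \<Sum>i\<in>UNIV. c i * E i p F) (E j p) = c j"
  by (subst g_sum) (auto simp: ET p g_EE if_distrib[of "\<lambda>x. _ * x"] cong: if_cong)

lemma expand: "v \<in> T p \<Longrightarrow> v = (\<lambda>F. \<Sum>i\<in>UNIV. g p v (E i p) * E i p F)"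
proof -
  assume "v \<in> T p"
  then obtain c where c: "v = (\<lambda>F. \<Sum>i\<in>UNIV. c i * E i p F)"
    using frame p unfolding orthonormal_frame_def by blast
  then have "g p v (E j p) = c j" for j
    by (simp only: g_sum_E)
  with c show ?thesis by simp
qed

text \<open>Derivations vanish by convention on functions that are not smooth near \<open>p\<close>,
  so the combination is the zero functional, and pairing it with \<open>E j\<close> extracts the
  coefficient. This frees identities of a contraction with an arbitrary differential.\<close>

lemma frame_independent:
  assumes "\<And>F. smooth_near M p F \<Longrightarrow> (\<Sum>i\<in>UNIV. c i * E i p F) = 0"
  shows "c j = 0"
proof -
  have "(\<Sum>i\<in>UNIV. c i * E i p F) = 0" for F
    using assms tangent_spaceD(1)[OF ET[OF p]] by (cases "smooth_near M p F") auto
  then have "c j = g p (\<lambda>F. 0) (E j p)"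
    using g_sum_E[of c j] by simp
  then show ?thesis by (simp add: g_zero ET p)
qed

lemma g_expand:
  assumes "u \<in> T p" "v \<in> T p"
  shows "g p u v = (\<Sum>l\<in>UNIV. g p u (E l p) * g p v (E l p))"
proof -
  have "g p u v = g p (\<lambda>F. \<Sum>i\<in>UNIV. g p u (E i p) * E i p F) v"
    using expand[OF assms(1)] by simp
  also have "\<dots> = (\<Sum>l\<in>UNIV. g p u (E l p) * g p (E l p) v)"
    by (rule g_sum) (auto simp: ET p assms)
  finally show ?thesis
    using g_sym[OF assms(2) ET[OF p]] by simp
qed

end

section \<open>The Levi-Civita connection and its curvature in the frame\<close>

lemma vf_conn: "vf X \<Longrightarrow> vf Y \<Longrightarrow> vf (mf_conn M X Y)"
  using lc openW sm_const unfolding levi_civita_def affine_connection_def by blast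

lemma sm_\<Gamma> [intro!]: "sm (\<Gamma> k i l)"
  unfolding conn_coeff_def[abs_def] by (intro sm_metric vf_conn vfE)

lemma metric_compat:
  "vf X \<Longrightarrow> vf Y \<Longrightarrow> vf Z \<Longrightarrow> p \<in> W \<Longrightarrow>
    X p (\<lambda>q. g q (Y q) (Z q)) = g p (mf_conn M X Y p) (Z p) + g p (Y p) (mf_conn M X Z p)"
  using lc openW unfolding levi_civita_def by blast

lemma torsion_free:
  "vf X \<Longrightarrow> vf Y \<Longrightarrow> p \<in> W \<Longrightarrow>
    bracket M X Y p = (\<lambda>G. mf_conn M X Y p G - mf_conn M Y X p G)"
  using lc openW unfolding levi_civita_def by metis

lemma conn_add:
  "vf X \<Longrightarrow> vf Y \<Longrightarrow> vf Z \<Longrightarrow> p \<in> W \<Longrightarrow>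
    mf_conn M (\<lambda>q G. X q G + Y q G) Z p = (\<lambda>G. mf_conn M X Z p G + mf_conn M Y Z p G)"
  using lc openW sm_const[of 0] unfolding levi_civita_def affine_connection_def by blast

lemma conn_mult:
  "vf X \<Longrightarrow> vf Z \<Longrightarrow> sm F \<Longrightarrow> p \<in> W \<Longrightarrow>
    mf_conn M (\<lambda>q G. F q * X q G) Z p = (\<lambda>G. F p * mf_conn M X Z p G)"
  using lc openW unfolding levi_civita_def affine_connection_def by blast

text \<open>The axioms of a connection speak about fields that are defined everywhere; locality in the
  direction argument follows by writing the difference of the two fields as its product with the
  indicator function of the complement of the domain.\<close>

lemma conn_cong:
  assumes "vf X" "vf Z" "p \<in> W" and eq: "\<And>q. q \<in> W \<Longrightarrow> X q = Y q"
  shows "mf_conn M X Z p = mf_conn M Y Z p"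
proof -
  define F :: "'a \<Rightarrow> real" where "F q = (if q \<in> W then 0 else 1)" for q
  define U where "U q G = Y q G - X q G" for q and G :: "'a \<Rightarrow> real"
  have smF: "sm F"
    by (rule sm_cong[OF sm_const[of 0]]) (simp add: F_def)
  have U: "vf U"
    by (rule vector_field_cong[OF smooth_mf vector_field_zero]) (simp add: U_def eq fun_eq_iff)
  have "(\<lambda>q G. F q * U q G) = U"
    by (auto simp: F_def U_def eq fun_eq_iff)
  then have "mf_conn M U Z p = (\<lambda>G. F p * mf_conn M U Z p G)"
    using conn_mult[OF U assms(2) smF assms(3)] by simp
  also have "\<dots> = (\<lambda>G. 0)"
    using assms(3) by (simp add: F_def)
  finally have "mf_conn M U Z p = (\<lambda>G. 0)" .
  then have "mf_conn M (\<lambda>q G. X q G + U q G) Z p = (\<lambda>G. mf_conn M X Z p G + 0)"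
    using conn_add[OF assms(1) U assms(2,3)] by simp
  then show ?thesis by (simp add: U_def)
qed

lemma conn_sum:
  assumes "finite I" "\<And>i. i \<in> I \<Longrightarrow> vf (X i)" "\<And>i. i \<in> I \<Longrightarrow> sm (c i)" "vf Z" "p \<in> W"
  shows "mf_conn M (\<lambda>q G. \<Sum>i\<in>I. c i q * X i q G) Z p = (\<lambda>G. \<Sum>i\<in>I. c i p * mf_conn M (X i) Z p G)"
  using assms(1-3)
proof (induction I rule: finite_induct)
  case empty
  show ?case
    using conn_mult[OF vector_field_zero[of M W] assms(4) sm_const[of 0] assms(5)] by simp
next
  case (insert i I)
  have "mf_conn M (\<lambda>q G. \<Sum>j\<in>insert i I. c j q * X j q G) Z p
    = mf_conn M (\<lambda>q G. c i q * X i q G + (\<Sum>j\<in>I. c j q * X j q G)) Z p"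
    using insert by simp
  also have "\<dots> = (\<lambda>G. mf_conn M (\<lambda>q G. c i q * X i q G) Z p G
      + mf_conn M (\<lambda>q G. \<Sum>j\<in>I. c j q * X j q G) Z p G)"
    using insert assms(4,5) by (intro conn_add vector_field_mult[OF smooth_mf] vector_field_sum[OF smooth_mf]) auto
  also have "\<dots> = (\<lambda>G. \<Sum>j\<in>insert i I. c j p * mf_conn M (X j) Z p G)"
    using insert assms(4,5) by (subst conn_mult) auto
  finally show ?case .
qed

text \<open>The inner products of the frame fields are constant, so metric compatibility makes the
  two coefficients cancel.\<close>

lemma \<Gamma>_antisym: "p \<in> W \<Longrightarrow> \<Gamma> k l i p = - \<Gamma> k i l p"
proof -
  assume p: "p \<in> W"
  have "E k p (\<lambda>q. g q (E i q) (E l q)) = E k p (\<lambda>q. kd i l)"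
    by (rule D_cong[OF p]) (auto intro!: sm_metric vfE simp: g_EE)
  then have "g p (mf_conn M (E k) (E i) p) (E l p) + g p (E i p) (mf_conn M (E k) (E l) p) = 0"
    using metric_compat[OF vfE vfE vfE p, of k i l] D_const[OF p] by simp
  then show ?thesis
    using g_sym[OF p ET[OF p] vfT[OF vf_conn[OF vfE vfE] p], of i k l]
    by (simp add: conn_coeff_def)
qed

lemma conn_expand: "p \<in> W \<Longrightarrow> mf_conn M (E k) (E i) p = (\<lambda>F. \<Sum>l\<in>UNIV. \<Gamma> k i l p * E l p F)"
  using expand[OF _ vfT[OF vf_conn[OF vfE vfE]], of p k i] by (simp add: conn_coeff_def)

lemma bracket_expand:
  "p \<in> W \<Longrightarrow> bracket M (E i) (E j) p = (\<lambda>F. \<Sum>l\<in>UNIV. (\<Gamma> i j l p - \<Gamma> j i l p) * E l p F)"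
  using torsion_free[OF vfE vfE, of p i j] conn_expand[of p i j] conn_expand[of p j i]
  by (simp add: algebra_simps sum_subtractf)

lemma D_commute:
  assumes "p \<in> W" "sm F"
  shows "E i p (\<lambda>q. E j q F) = E j p (\<lambda>q. E i q F) + (\<Sum>l\<in>UNIV. (\<Gamma> i j l p - \<Gamma> j i l p) * E l p F)"
  using fun_cong[OF bracket_expand[OF assms(1), of i j], of F] sm_near[OF assms(2,1)]
  by (simp add: bracket_def)

text \<open>Expanding the inner derivative in the frame and differentiating again would require
  locality of \<open>mf_conn\<close> in its second argument. Metric compatibility avoids this: the
  outer derivative falls on the scalar \<open>\<Gamma> b j i\<close>, at the price of an inner
  product of two covariant derivatives.\<close>

lemma riem_eq:
  assumes p: "p \<in> W"
  shows "riem M E i j k t p = E k p (\<Gamma> t j i) - E t p (\<Gamma> k j i)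
    - (\<Sum>l\<in>UNIV. \<Gamma> t j l p * \<Gamma> k i l p) + (\<Sum>l\<in>UNIV. \<Gamma> k j l p * \<Gamma> t i l p)
    - (\<Sum>l\<in>UNIV. (\<Gamma> k t l p - \<Gamma> t k l p) * \<Gamma> l j i p)"
proof -
  have D: "g p (mf_conn M (E a) (mf_conn M (E b) (E j)) p) (E i p)
      = E a p (\<Gamma> b j i) - (\<Sum>l\<in>UNIV. \<Gamma> b j l p * \<Gamma> a i l p)" for a b
    using metric_compat[OF vfE vf_conn[OF vfE vfE] vfE p, of a b j i]
      g_expand[OF p vfT[OF vf_conn[OF vfE vfE] p] vfT[OF vf_conn[OF vfE vfE] p], of b j a i]
    by (simp add: conn_coeff_def[abs_def])
  have vb: "vf (\<lambda>q G. \<Sum>l\<in>UNIV. (\<Gamma> k t l q - \<Gamma> t k l q) * E l q G)"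
    by (rule vector_field_sum[OF smooth_mf]) (auto simp: vfE)
  \<comment> \<open>The frame expansion of the bracket is valid on \<open>W\<close> only; locality
    in the direction argument suffices here.\<close>
  have "mf_conn M (bracket M (E k) (E t)) (E j) p
      = mf_conn M (\<lambda>q G. \<Sum>l\<in>UNIV. (\<Gamma> k t l q - \<Gamma> t k l q) * E l q G) (E j) p"
    by (rule conn_cong[OF vb vfE p, symmetric]) (simp add: bracket_expand)
  also have "\<dots> = (\<lambda>G. \<Sum>l\<in>UNIV. (\<Gamma> k t l p - \<Gamma> t k l p) * mf_conn M (E l) (E j) p G)"
    by (rule conn_sum) (auto simp: vfE p)
  finally have B: "mf_conn M (bracket M (E k) (E t)) (E j) p = \<dots>" .
  have "g p (mf_conn M (bracket M (E k) (E t)) (E j) p) (E i p)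
      = (\<Sum>l\<in>UNIV. (\<Gamma> k t l p - \<Gamma> t k l p) * \<Gamma> l j i p)"
    unfolding B conn_coeff_def[of M E _ j i]
    by (rule g_sum[OF p]) (auto simp: ET p intro!: vfT vf_conn vfE)
  moreover have "mf_conn M (bracket M (E k) (E t)) (E j) p \<in> T p"
    unfolding B by (rule tangent_space_sum) (auto intro!: vfT vf_conn vfE p)
  moreover have "g p (\<lambda>F. u F - v F - w F) e = g p u e - g p v e - g p w e"
    if "u \<in> T p" "v \<in> T p" "w \<in> T p" "e \<in> T p" for u v w e
    using g_lin[OF p that(1) tangent_space_lincomb[OF that(2,3), of 1 1] that(4), of 1 "-1"]
      g_lin[OF p that(2,3,4), of 1 1] by (simp add: algebra_simps)
  ultimately show ?thesis
    unfolding riem_def curvature_def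
    by (simp add: D vfT vf_conn vfE p)
qed

lemma sm_riem [intro!]: "sm (riem M E i j k t)"
  by (rule sm_cong[OF _ riem_eq[symmetric]]) auto

lemma riem_antisym_right: "p \<in> W \<Longrightarrow> riem M E i j t k p = - riem M E i j k t p"
  by (simp add: riem_eq sum_subtractf[symmetric] sum_negf[symmetric] algebra_simps)

lemma riem_antisym_left: "p \<in> W \<Longrightarrow> riem M E j i k t p = - riem M E i j k t p"
proof -
  assume p: "p \<in> W"
  have "E a p (\<Gamma> b i j) = - E a p (\<Gamma> b j i)" for a b
    using D_cong[OF p sm_\<Gamma>[of b i j], of "\<lambda>q. (-1) * \<Gamma> b j i q" a] D_cmult[OF p sm_\<Gamma>[of b j i], of a "-1"]
      \<Gamma>_antisym[of _ b i j] by simp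
  then show ?thesis
    using p by (simp add: riem_eq \<Gamma>_antisym[of p _ i j] sum_negf mult.commute)
qed

end

section \<open>Ricci identities and the first Bianchi identity\<close>

definition cov4 :: "('a, 'm::finite) rmanifold \<Rightarrow> ('a, 'm) frame \<Rightarrow>
    ('m \<Rightarrow> 'm \<Rightarrow> 'm \<Rightarrow> 'm \<Rightarrow> 'a \<Rightarrow> real) \<Rightarrow> 'm \<Rightarrow> 'm \<Rightarrow> 'm \<Rightarrow> 'm \<Rightarrow> 'm \<Rightarrow> 'a \<Rightarrow> real" where
  "cov4 M E T i j h t k p = E k p (T i j h t)
     - (\<Sum>l\<in>UNIV. conn_coeff M E k i l p * T l j h t p)
     - (\<Sum>l\<in>UNIV. conn_coeff M E k j l p * T i l h t p)
     - (\<Sum>l\<in>UNIV. conn_coeff M E k h l p * T i j l t p)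
     - (\<Sum>l\<in>UNIV. conn_coeff M E k t l p * T i j h l p)"

lemma sum_kd [simp]:
  fixes f :: "'m::finite \<Rightarrow> real"
  shows "(\<Sum>l\<in>UNIV. kd i l * f l) = f i" "(\<Sum>l\<in>UNIV. kd l i * f l) = f i"
    "(\<Sum>l\<in>UNIV. f l * kd i l) = f i" "(\<Sum>l\<in>UNIV. f l * kd l i) = f i"
  by (simp_all add: if_distrib[of "\<lambda>x. _ * x"] if_distrib[of "\<lambda>x. x * _"] cong: if_cong)

context ortho_frame
begin

lemma sm_dfun [intro!]: "sm F \<Longrightarrow> sm (dfun E F i)"
  unfolding dfun_def[abs_def] by auto

lemma sm_cov1 [intro!]: "(\<And>i. sm (X i)) \<Longrightarrow> sm (cov1 M E X i k)"
  unfolding cov1_def[abs_def] by auto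

lemma sm_cov2 [intro!]: "(\<And>i j. sm (X i j)) \<Longrightarrow> sm (cov2 M E X i j k)"
  unfolding cov2_def[abs_def] by auto

lemma sm_hess [intro!]: "sm F \<Longrightarrow> sm (hess M E F i j)"
  unfolding hess_def by auto

text \<open>Covariant derivative and curvature of a connection with coefficients \<open>H\<close> on a bundle with
  a frame indexed by \<open>'i\<close>. The instances are the bundles of tensors of rank one and two.\<close>

definition nab :: "('m \<Rightarrow> 'i::finite \<Rightarrow> 'i \<Rightarrow> 'a \<Rightarrow> real) \<Rightarrow> ('i \<Rightarrow> 'a \<Rightarrow> real) \<Rightarrow> 'i \<Rightarrow> 'm \<Rightarrow> 'a \<Rightarrow> real"
  where "nab H X I k p = E k p (X I) - (\<Sum>J\<in>UNIV. H k I J p * X J p)"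

definition curv :: "('m \<Rightarrow> 'i::finite \<Rightarrow> 'i \<Rightarrow> 'a \<Rightarrow> real) \<Rightarrow> 'm \<Rightarrow> 'm \<Rightarrow> 'i \<Rightarrow> 'i \<Rightarrow> 'a \<Rightarrow> real" where
  "curv H k j I K p = E j p (H k I K) - E k p (H j I K)
     + (\<Sum>J\<in>UNIV. H k I J p * H j J K p) - (\<Sum>J\<in>UNIV. H j I J p * H k J K p)
     + (\<Sum>l\<in>UNIV. (\<Gamma> k j l p - \<Gamma> j k l p) * H l I K p)"

text \<open>In \<open>nab\<close> the index of the earlier derivative is a mere label without a
  correction term. The first sum on the right is exactly what skew-symmetrising the missing
  correction gives, so it disappears for genuine second covariant derivatives and only curvature
  remains.\<close>

lemma nab_commute:
  assumes smH: "\<And>k I J. sm (H k I J)" and p: "p \<in> W" and X: "\<And>I. sm (X I)"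
  shows "nab H (\<lambda>J. nab H X J j) I k p - nab H (\<lambda>J. nab H X J k) I j p
    = (\<Sum>l\<in>UNIV. (\<Gamma> k j l p - \<Gamma> j k l p) * nab H X I l p) + (\<Sum>J\<in>UNIV. curv H k j I J p * X J p)"
proof -
  have D: "E k p (nab H X I j) = E k p (\<lambda>q. E j q (X I))
      - (\<Sum>J\<in>UNIV. E k p (H j I J) * X J p) - (\<Sum>J\<in>UNIV. H j I J p * E k p (X J))" for k j
    unfolding nab_def[abs_def]
    by (subst D_diff[OF p] D_sum[OF p] D_mult[OF p] | intro sm_sum sm_mult sm_D smH X)+
      (simp add: sum.distrib)
  have S: "(\<Sum>J\<in>UNIV. H k I J p * nab H X J j p) = (\<Sum>J\<in>UNIV. H k I J p * E j p (X J))
      - (\<Sum>K\<in>UNIV. (\<Sum>J\<in>UNIV. H k I J p * H j J K p) * X K p)" for k j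
    unfolding nab_def right_diff_distrib sum_subtractf sum_distrib_left sum_distrib_right
    by (subst (2) sum.swap) (simp add: mult.assoc)
  have C: "(\<Sum>l\<in>UNIV. (\<Gamma> k j l p - \<Gamma> j k l p) * nab H X I l p)
      = (\<Sum>l\<in>UNIV. (\<Gamma> k j l p - \<Gamma> j k l p) * E l p (X I))
        - (\<Sum>K\<in>UNIV. (\<Sum>l\<in>UNIV. (\<Gamma> k j l p - \<Gamma> j k l p) * H l I K p) * X K p)"
    unfolding nab_def right_diff_distrib sum_subtractf sum_distrib_left sum_distrib_right
    by (subst (2) sum.swap) (simp add: mult.assoc)
  have "nab H (\<lambda>J. nab H X J j) I k p - nab H (\<lambda>J. nab H X J k) I j p
    = (E k p (nab H X I j) - (\<Sum>J\<in>UNIV. H k I J p * nab H X J j p))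
      - (E j p (nab H X I k) - (\<Sum>J\<in>UNIV. H j I J p * nab H X J k p))"
    by (simp only: nab_def[of H "\<lambda>J. nab H X J _"])
  then show ?thesis
    using D_commute[OF p X, of k j I]
    unfolding D S C curv_def
    by (simp add: distrib_right left_diff_distrib sum.distrib sum_subtractf)
qed

lemma curv_\<Gamma>: "p \<in> W \<Longrightarrow> curv \<Gamma> k j i t p = riem M E t i j k p"
  unfolding curv_def riem_eq
  by (simp add: \<Gamma>_antisym[of p _ t] sum_negf algebra_simps sum_subtractf)

lemma ricci_identity1:
  assumes p: "p \<in> W" and X [intro!]: "\<And>i. sm (X i)"
  shows "cov2 M E (cov1 M E X) i j k p - cov2 M E (cov1 M E X) i k j p
    = (\<Sum>t\<in>UNIV. X t p * riem M E t i j k p)"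
proof -
  have n: "cov1 M E X = nab \<Gamma> X"
    by (intro ext) (simp add: cov1_def nab_def)
  have c: "cov2 M E (cov1 M E X) i j k p
      = nab \<Gamma> (\<lambda>J. nab \<Gamma> X J j) i k p - (\<Sum>l\<in>UNIV. \<Gamma> k j l p * nab \<Gamma> X i l p)" for j k
    by (simp add: cov2_def n nab_def[of \<Gamma> "\<lambda>J. nab \<Gamma> X J _"])
  show ?thesis
    unfolding c using nab_commute[of \<Gamma> p X j i k, OF sm_\<Gamma> p X]
    by (simp add: curv_\<Gamma>[OF p] algebra_simps sum_subtractf)
qed

lemma ricci_identity2:
  assumes p: "p \<in> W" and X [intro!]: "\<And>i j. sm (X i j)"
  shows "cov3 M E (cov2 M E X) i h j k p - cov3 M E (cov2 M E X) i h k j p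
    = (\<Sum>t\<in>UNIV. X t h p * riem M E t i j k p) + (\<Sum>t\<in>UNIV. X i t p * riem M E t h j k p)"
proof -
  \<comment> \<open>The induced connection on tensors of rank two, seen as a bundle whose frame is
    indexed by pairs: \<Gamma> acts on one index and the identity on the other.\<close>
  define H where "H k I J q = \<Gamma> k (fst I) (fst J) q * kd (snd I) (snd J)
    + kd (fst I) (fst J) * \<Gamma> k (snd I) (snd J) q" for k and I J :: "'m \<times> 'm" and q
  define Y where "Y I = X (fst I) (snd I)" for I
  have H [intro!]: "sm (H k I J)" for k I J
    unfolding H_def[abs_def] by auto
  have Y: "sm (Y I)" for I
    unfolding Y_def by auto
  have pair: "(\<Sum>J\<in>UNIV. f J) = (\<Sum>a\<in>UNIV. \<Sum>b\<in>UNIV. f (a, b))" for f :: "'m \<times> 'm \<Rightarrow> real"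
    unfolding sum.cartesian_product by simp
  have Hs: "(\<Sum>J\<in>UNIV. H k (i, h) J q * f J)
      = (\<Sum>a\<in>UNIV. \<Gamma> k i a q * f (a, h)) + (\<Sum>b\<in>UNIV. \<Gamma> k h b q * f (i, b))" for k i h f q
    unfolding pair H_def fst_conv snd_conv distrib_right sum.distrib mult.assoc sum_distrib_left[symmetric] sum_kd
    by simp
  have n: "nab H Y (i, h) = cov2 M E X i h" for i h
    by (intro ext) (simp add: cov2_def nab_def Hs, simp add: Y_def)
  have c: "cov3 M E (cov2 M E X) i h j k p
      = nab H (\<lambda>J. nab H Y J j) (i, h) k p - (\<Sum>l\<in>UNIV. \<Gamma> k j l p * nab H Y (i, h) l p)" for j k
    by (simp add: cov3_def nab_def[of H "\<lambda>J. nab H Y J _"] Hs n)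
  have DH: "E j p (H k (i, h) (a, b)) = E j p (\<Gamma> k i a) * kd h b + kd i a * E j p (\<Gamma> k h b)"
    for j k a b
    unfolding H_def[abs_def] fst_conv snd_conv
    by (subst D_add[OF p] D_mult[OF p] | intro sm_mult sm_\<Gamma> sm_const)+ (simp add: D_const[OF p])
  \<comment> \<open>The two mixed products are unchanged as a pair when \<open>j\<close> and
    \<open>k\<close> are exchanged. They cancel in \<open>curv\<close>, which is why the curvature
    acts on each index separately.\<close>
  have HH: "(\<Sum>J\<in>UNIV. H k (i, h) J p * H j J (a, b) p)
      = (\<Sum>c\<in>UNIV. \<Gamma> k i c p * \<Gamma> j c a p) * kd h b + \<Gamma> k i a p * \<Gamma> j h b p
        + \<Gamma> k h b p * \<Gamma> j i a p + kd i a * (\<Sum>c\<in>UNIV. \<Gamma> k h c p * \<Gamma> j c b p)" for j k a b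
  proof -
    have "(\<Sum>c\<in>UNIV. \<Gamma> k i c p * H j (c, h) (a, b) p)
      = (\<Sum>c\<in>UNIV. \<Gamma> k i c p * \<Gamma> j c a p * kd h b) + (\<Sum>c\<in>UNIV. \<Gamma> k i c p * \<Gamma> j h b p * kd c a)"
      by (simp only: H_def fst_conv snd_conv sum.distrib[symmetric]) (simp add: algebra_simps)
    moreover have "(\<Sum>c\<in>UNIV. \<Gamma> k h c p * H j (i, c) (a, b) p)
      = (\<Sum>c\<in>UNIV. \<Gamma> k h c p * \<Gamma> j i a p * kd c b) + (\<Sum>c\<in>UNIV. kd i a * (\<Gamma> k h c p * \<Gamma> j c b p))"
      by (simp only: H_def fst_conv snd_conv sum.distrib[symmetric]) (simp add: algebra_simps)
    ultimately show ?thesis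
      unfolding Hs sum_kd sum_distrib_left sum_distrib_right by simp
  qed
  have R: "curv H k j (i, h) (a, b) p = riem M E a i j k p * kd h b + kd i a * riem M E b h j k p" for a b
  proof -
    have "(\<Sum>l\<in>UNIV. (\<Gamma> k j l p - \<Gamma> j k l p) * H l (i, h) (a, b) p)
      = (\<Sum>l\<in>UNIV. (\<Gamma> k j l p - \<Gamma> j k l p) * \<Gamma> l i a p) * kd h b
        + kd i a * (\<Sum>l\<in>UNIV. (\<Gamma> k j l p - \<Gamma> j k l p) * \<Gamma> l h b p)"
      by (simp only: H_def fst_conv snd_conv sum.distrib[symmetric] sum_distrib_left sum_distrib_right)
        (simp add: algebra_simps)
    then show ?thesis
      unfolding curv_\<Gamma>[OF p, symmetric] curv_def DH HH by (simp add: algebra_simps)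
  qed
  have "(\<Sum>J\<in>UNIV. curv H k j (i, h) J p * Y J p)
      = (\<Sum>t\<in>UNIV. riem M E t i j k p * X t h p) + (\<Sum>t\<in>UNIV. riem M E t h j k p * X i t p)"
    unfolding pair R Y_def fst_conv snd_conv distrib_right sum.distrib mult.assoc
      sum_distrib_left[symmetric] sum_kd by simp
  then show ?thesis
    unfolding c using nab_commute[of H p Y j "(i, h)" k, OF H p Y]
    by (simp add: algebra_simps sum_subtractf)
qed

lemma cov2_cong:
  "p \<in> W \<Longrightarrow> (\<And>i j. sm (X i j)) \<Longrightarrow> (\<And>i j q. q \<in> W \<Longrightarrow> X i j q = Y i j q) \<Longrightarrow>
    cov2 M E X i j k p = cov2 M E Y i j k p"
  unfolding cov2_def using D_cong[of p "X i j" "Y i j" k] by simp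

lemma cov3_cong:
  "p \<in> W \<Longrightarrow> (\<And>i j h. sm (X i j h)) \<Longrightarrow> (\<And>i j h q. q \<in> W \<Longrightarrow> X i j h q = Y i j h q) \<Longrightarrow>
    cov3 M E X i j h k p = cov3 M E Y i j h k p"
  unfolding cov3_def using D_cong[of p "X i j h" "Y i j h" k] by simp

lemma cov4_cong:
  "p \<in> W \<Longrightarrow> (\<And>i j h t. sm (X i j h t)) \<Longrightarrow> (\<And>i j h t q. q \<in> W \<Longrightarrow> X i j h t q = Y i j h t q) \<Longrightarrow>
    cov4 M E X i j h t k p = cov4 M E Y i j h t k p"
  unfolding cov4_def using D_cong[of p "X i j h t" "Y i j h t" k] by simp

section \<open>Symmetry of the Hessian and the first Bianchi identity\<close>

lemma hess_sym:
  assumes "p \<in> W" "sm F"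
  shows "hess M E F i j p = hess M E F j i p"
  using D_commute[OF assms, of j i]
  by (simp add: hess_def cov1_def dfun_def[abs_def] left_diff_distrib sum_subtractf)

text \<open>The Ricci identity turns each summand into f_ijk - f_ikj. Since the Hessian is
  symmetric, third derivatives are symmetric in their first two indices, and the six terms of the
  cyclic sum cancel in pairs.\<close>

lemma riem_cyclic_dfun:
  assumes p: "p \<in> W" and F [intro!]: "sm F"
  shows "(\<Sum>t\<in>UNIV. (riem M E t i j k p + riem M E t j k i p + riem M E t k i j p) * E t p F) = 0"
proof -
  have s: "cov2 M E (hess M E F) i j k p = cov2 M E (hess M E F) j i k p" for i j k
  proof -
    have "cov2 M E (hess M E F) i j k p = cov2 M E (\<lambda>i j. hess M E F j i) i j k p"
      by (rule cov2_cong[OF p]) (auto intro: hess_sym F)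
    then show ?thesis by (simp add: cov2_def)
  qed
  have r: "cov2 M E (hess M E F) i j k p - cov2 M E (hess M E F) i k j p
      = (\<Sum>t\<in>UNIV. riem M E t i j k p * E t p F)" for i j k
    using ricci_identity1[OF p, of "dfun E F" i j k] sm_dfun[OF F] by (simp add: hess_def dfun_def mult.commute)
  show ?thesis
    unfolding distrib_right sum.distrib r[symmetric]
    using s[of i j k] s[of i k j] s[of j k i] by simp
qed

lemma ortho_frame_subset:
  assumes "openin (mf_top M) V" "V \<subseteq> W"
  shows "ortho_frame M V E"
  using riem_mf lc frame assms
  by (auto simp: ortho_frame_def orthonormal_frame_def intro: vector_field_subset)

text \<open>The cyclic sum annihilates the differential of every function smooth near
  \<open>p\<close>, hence vanishes. Such a function may be smooth only on a smaller neighbourhood,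
  so the frame is restricted to \<open>W \<inter> V\<close>; the components at \<open>p\<close> are
  the same expressions.\<close>

lemma bianchi1:
  assumes p: "p \<in> W"
  shows "riem M E t i j k p + riem M E t j k i p + riem M E t k i j p = 0"
proof (rule frame_independent[OF p,
      where c = "\<lambda>t. riem M E t i j k p + riem M E t j k i p + riem M E t k i j p"])
  fix F assume "smooth_near M p F"
  then obtain V where V: "openin (mf_top M) V" "p \<in> V" "smooth_fun M V F"
    by (auto simp: smooth_near_def)
  then interpret V: ortho_frame M "W \<inter> V" E
    using openW by (intro ortho_frame_subset) auto
  show "(\<Sum>t\<in>UNIV. (riem M E t i j k p + riem M E t j k i p + riem M E t k i j p) * E t p F) = 0"
    using V p by (intro V.riem_cyclic_dfun) (auto intro: smooth_fun_subset)
qed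

text \<open>The usual octahedron argument: four cyclic identities on the indices, combined linearly
  with the skew-symmetry in each pair.\<close>

lemma riem_pair_sym:
  assumes p: "p \<in> W"
  shows "riem M E k t i j p = riem M E i j k t p"
  using bianchi1[OF p, of i j k t] bianchi1[OF p, of j k t i] bianchi1[OF p, of k t i j] bianchi1[OF p, of t i j k]
    riem_antisym_left[OF p] riem_antisym_right[OF p] by smt

end

section \<open>Contractions and the second Bianchi identity\<close>

lemma sum_mult_swap:
  fixes c :: "'b \<Rightarrow> real"
  shows "(\<Sum>a\<in>A. c a * (\<Sum>t\<in>B. x t * y t a)) = (\<Sum>t\<in>B. x t * (\<Sum>a\<in>A. c a * y t a))"
  unfolding sum_distrib_left by (subst sum.swap) (simp add: mult.left_commute)

lemma sum_mult_swap1: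
  fixes c :: "'b \<Rightarrow> real"
  shows "(\<Sum>a\<in>A. c a * (\<Sum>t\<in>B. y t a)) = (\<Sum>t\<in>B. \<Sum>a\<in>A. c a * y t a)"
  using sum_mult_swap[of c "\<lambda>t. 1" y B A] by simp

context ortho_frame
begin

lemma D_uminus: "p \<in> W \<Longrightarrow> sm F \<Longrightarrow> E k p (\<lambda>q. - F q) = - E k p F"
  using D_cmult[of p F k "-1"] by simp

lemma D_sum_mult:
  assumes p: "p \<in> W" and [intro!]: "\<And>i. sm (F i)" "\<And>i. sm (G i)"
  shows "E k p (\<lambda>q. \<Sum>i\<in>I. F i q * G i q) = (\<Sum>i\<in>I. E k p (F i) * G i p) + (\<Sum>i\<in>I. F i p * E k p (G i))"
  by (simp add: D_sum[OF p] D_mult[OF p] assms sm_mult sum.distrib)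

text \<open>This form of skew-symmetry makes covariant differentiation commute with contraction: the
  corrections for the two contracted indices cancel.\<close>

lemma \<Gamma>_trace:
  assumes "p \<in> W"
  shows "(\<Sum>t\<in>UNIV. \<Sum>s\<in>UNIV. \<Gamma> l t s p * z t s) = - (\<Sum>t\<in>UNIV. \<Sum>s\<in>UNIV. \<Gamma> l t s p * z s t)"
proof -
  have "\<Gamma> l t s p * z t s = - (\<Gamma> l s t p * z t s)" for t s
    using \<Gamma>_antisym[OF assms, of l t s] by simp
  then show ?thesis
    unfolding sum_negf[symmetric] by (subst sum.swap) (intro sum.cong refl)
qed

lemma cov2_kd:
  assumes p: "p \<in> W" and F: "sm F"
  shows "cov2 M E (\<lambda>i j q. F q * kd i j) i j k p = E k p F * kd i j"
proof -
  have "E k p (\<lambda>q. F q * kd i j) = E k p F * kd i j"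
    by (subst D_mult[OF p F sm_const]) (simp add: D_const[OF p])
  moreover have "(\<Sum>l\<in>UNIV. \<Gamma> k i l p * (F p * kd l j)) = \<Gamma> k i j p * F p"
    "(\<Sum>l\<in>UNIV. \<Gamma> k j l p * (F p * kd i l)) = \<Gamma> k j i p * F p"
    unfolding mult.assoc[symmetric] by (rule sum_kd)+
  ultimately show ?thesis
    unfolding cov2_def using \<Gamma>_antisym[OF p, of k i j] by simp
qed

lemma cov2_mult:
  assumes p: "p \<in> W" and X: "\<And>i. sm (X i)"
  shows "cov2 M E (\<lambda>i j q. X i q * X j q) i j k p = cov1 M E X i k p * X j p + X i p * cov1 M E X j k p"
  unfolding cov2_def cov1_def
  by (simp add: D_mult[OF p X X] algebra_simps sum_distrib_left)

lemma cov4_kd: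
  assumes p: "p \<in> W" and X: "\<And>i j. sm (X i j)"
  shows "cov4 M E (\<lambda>i j h t q. X i h q * kd j t) i j h t k p = cov2 M E X i h k p * kd j t"
proof -
  have "E k p (\<lambda>q. X i h q * kd j t) = E k p (X i h) * kd j t"
    by (subst D_mult[OF p X sm_const]) (simp add: D_const[OF p])
  moreover have "(\<Sum>l\<in>UNIV. \<Gamma> k j l p * (X i h p * kd l t)) = \<Gamma> k j t p * X i h p"
    "(\<Sum>l\<in>UNIV. \<Gamma> k t l p * (X i h p * kd j l)) = \<Gamma> k t j p * X i h p"
    unfolding mult.assoc[symmetric] by (rule sum_kd)+
  moreover have "(\<Sum>l\<in>UNIV. \<Gamma> k i l p * (X l h p * kd j t)) = (\<Sum>l\<in>UNIV. \<Gamma> k i l p * X l h p) * kd j t"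
    "(\<Sum>l\<in>UNIV. \<Gamma> k h l p * (X i l p * kd j t)) = (\<Sum>l\<in>UNIV. \<Gamma> k h l p * X i l p) * kd j t"
    by (simp_all only: sum_distrib_right mult.assoc)
  ultimately show ?thesis
    unfolding cov4_def cov2_def using \<Gamma>_antisym[OF p, of k j t] by (simp add: left_diff_distrib)
qed

lemma cov3_contract:
  assumes p: "p \<in> W" and X: "\<And>i. sm (X i)" and Y: "\<And>i j h t. sm (Y i j h t)"
  shows "cov3 M E (\<lambda>i j h q. \<Sum>t\<in>UNIV. X t q * Y t i j h q) i j h k p
    = (\<Sum>t\<in>UNIV. cov1 M E X t k p * Y t i j h p) + (\<Sum>t\<in>UNIV. X t p * cov4 M E Y t i j h k p)"
proof -
  \<comment> \<open>On the right both factors carry a correction for the summed index, on the left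
    there is none. Moving the connection coefficient from \<open>X\<close> to \<open>Y\<close>
    reverses its sign, so the two corrections cancel.\<close>
  have "(\<Sum>t\<in>UNIV. (\<Sum>s\<in>UNIV. \<Gamma> k t s p * X s p) * Y t i j h p)
      = - (\<Sum>t\<in>UNIV. X t p * (\<Sum>s\<in>UNIV. \<Gamma> k t s p * Y s i j h p))"
    using \<Gamma>_trace[OF p, of k "\<lambda>t s. X s p * Y t i j h p"]
    by (simp add: sum_distrib_left sum_distrib_right algebra_simps)
  moreover have "(\<Sum>l\<in>UNIV. \<Gamma> k a l p * (\<Sum>t\<in>UNIV. X t p * Z t l)) = (\<Sum>t\<in>UNIV. X t p * (\<Sum>l\<in>UNIV. \<Gamma> k a l p * Z t l))"
    for a and Z :: "'m \<Rightarrow> 'm \<Rightarrow> real"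
    by (rule sum_mult_swap)
  note this[of i "\<lambda>t l. Y t l j h p"] this[of j "\<lambda>t l. Y t i l h p"] this[of h "\<lambda>t l. Y t i j l p"]
  ultimately show ?thesis
    unfolding cov3_def cov1_def cov4_def D_sum_mult[OF p X Y]
    by (simp add: right_diff_distrib left_diff_distrib sum_subtractf)
qed

lemma cov3_antisym:
  assumes p: "p \<in> W" and X: "\<And>i j h. sm (X i j h)"
  shows "cov3 M E (\<lambda>i j h q. X i j h q - X i h j q) i j h k p
    = cov3 M E X i j h k p - cov3 M E X i h j k p"
  unfolding cov3_def by (simp add: D_diff[OF p X X] right_diff_distrib sum_subtractf)

lemma cov3_trace:
  assumes p: "p \<in> W" and X: "\<And>i j h. sm (X i j h)"
  shows "(\<Sum>h\<in>UNIV. cov3 M E X h i h k p) = cov1 M E (\<lambda>i q. \<Sum>h\<in>UNIV. X h i h q) i k p"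
  unfolding cov3_def cov1_def sum_mult_swap1
  using \<Gamma>_trace[OF p, of k "\<lambda>t s. X s i t p"]
  by (simp add: D_sum[OF p] X sum_subtractf)

lemma cov4_riem_antisym_right:
  assumes p: "p \<in> W"
  shows "cov4 M E (riem M E) i j t h k p = - cov4 M E (riem M E) i j h t k p"
proof -
  have "cov4 M E (riem M E) i j t h k p = cov4 M E (\<lambda>i j t h q. - riem M E i j h t q) i j t h k p"
    by (rule cov4_cong[OF p]) (auto intro: riem_antisym_right)
  also have "\<dots> = - cov4 M E (riem M E) i j h t k p"
    unfolding cov4_def by (simp add: D_uminus[OF p sm_riem] sum_negf)
  finally show ?thesis .
qed

lemma cov4_riem_pair_sym:
  assumes p: "p \<in> W"
  shows "cov4 M E (riem M E) h t i j k p = cov4 M E (riem M E) i j h t k p"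
proof -
  have "cov4 M E (riem M E) h t i j k p = cov4 M E (\<lambda>h t i j. riem M E i j h t) h t i j k p"
    by (rule cov4_cong[OF p]) (auto intro: riem_pair_sym)
  then show ?thesis
    unfolding cov4_def by simp
qed

lemma cov4_riem_antisym_left:
  assumes p: "p \<in> W"
  shows "cov4 M E (riem M E) j i h t k p = - cov4 M E (riem M E) i j h t k p"
  using cov4_riem_pair_sym[OF p] cov4_riem_antisym_right[OF p] by metis

text \<open>Comparing the cyclic sums of the derivative of the Ricci identity for a one-form with those of
  the Ricci identity for its covariant derivative, everything but the derivative of the curvature
  tensor cancels.\<close>

lemma bianchi2:
  assumes p: "p \<in> W"
  shows "cov4 M E (riem M E) t i j h k p + cov4 M E (riem M E) t i h k j p
    + cov4 M E (riem M E) t i k j h p = 0"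
proof -
  \<comment> \<open>Constant components select the index \<open>t\<close> when contracted with the
    curvature tensor. This one-form need not be parallel, so terms with its covariant derivative
    appear and have to cancel.\<close>
  define X :: "'m \<Rightarrow> 'a \<Rightarrow> real" where "X s q = kd t s" for s q
  have X: "sm (X s)" for s
    unfolding X_def[abs_def] by auto
  note X1 = sm_cov1[of X, OF X] and X2 = sm_cov2[of "cov1 M E X", OF sm_cov1[of X, OF X]]
  have 1: "cov3 M E (cov2 M E (cov1 M E X)) i j h k p - cov3 M E (cov2 M E (cov1 M E X)) i h j k p
    = (\<Sum>s\<in>UNIV. cov1 M E X s k p * riem M E s i j h p) + cov4 M E (riem M E) t i j h k p" for j h k
  proof -
    have "cov3 M E (cov2 M E (cov1 M E X)) i j h k p - cov3 M E (cov2 M E (cov1 M E X)) i h j k p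
      = cov3 M E (\<lambda>i j h q. \<Sum>s\<in>UNIV. X s q * riem M E s i j h q) i j h k p"
      unfolding cov3_antisym[OF p X2, symmetric]
      by (rule cov3_cong[OF p sm_diff[OF X2 X2]]) (rule ricci_identity1[OF _ X])
    then show ?thesis
      unfolding cov3_contract[OF p X sm_riem] by (simp add: X_def)
  qed
  have 2: "cov3 M E (cov2 M E (cov1 M E X)) i j h k p - cov3 M E (cov2 M E (cov1 M E X)) i j k h p
    = (\<Sum>s\<in>UNIV. cov1 M E X s j p * riem M E s i h k p) + (\<Sum>s\<in>UNIV. cov1 M E X i s p * riem M E s j h k p)" for j h k
    by (rule ricci_identity2[OF p X1])
  \<comment> \<open>These terms come from the curvature acting on the derivative index of
    \<open>cov1 M E X\<close>. The first Bianchi identity removes them; the remaining terms with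
    derivatives of \<open>X\<close> agree in both cyclic sums.\<close>
  have "(\<Sum>s\<in>UNIV. cov1 M E X i s p * riem M E s j h k p) + (\<Sum>s\<in>UNIV. cov1 M E X i s p * riem M E s h k j p)
      + (\<Sum>s\<in>UNIV. cov1 M E X i s p * riem M E s k j h p) = 0"
    unfolding sum.distrib[symmetric] distrib_left[symmetric] bianchi1[OF p] by simp
  with 1[of j h k] 1[of h k j] 1[of k j h] 2[of j h k] 2[of h k j] 2[of k j h]
  show ?thesis by linarith
qed

section \<open>Ricci tensor, scalar curvature and the contracted Bianchi identities\<close>

lemma sm_ric [intro!]: "sm (ric M E i j)"
  unfolding ric_def[abs_def] by auto

lemma sm_scal [intro!]: "sm (scal M E)"
  unfolding scal_def[abs_def] by auto

lemma ric_sym: "p \<in> W \<Longrightarrow> ric M E i j p = ric M E j i p"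
  unfolding ric_def by (simp add: riem_pair_sym[of p i _ j])

lemma cov2_ric:
  assumes p: "p \<in> W"
  shows "cov2 M E (ric M E) i j k p = (\<Sum>t\<in>UNIV. cov4 M E (riem M E) i t j t k p)"
proof -
  have "E k p (ric M E i j) = (\<Sum>t\<in>UNIV. E k p (riem M E i t j t))"
    unfolding ric_def[abs_def] by (rule D_sum[OF p]) auto
  then show ?thesis
    unfolding cov2_def cov4_def ric_def sum_mult_swap1
    using \<Gamma>_trace[OF p, of k "\<lambda>t s. riem M E i s j t p"]
    by (simp add: sum_subtractf)
qed

lemma cov2_ric_sym:
  assumes p: "p \<in> W"
  shows "cov2 M E (ric M E) i j k p = cov2 M E (ric M E) j i k p"
  unfolding cov2_ric[OF p] by (simp add: cov4_riem_pair_sym[OF p, of i _ j])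

lemma D_scal:
  assumes p: "p \<in> W"
  shows "E k p (scal M E) = (\<Sum>t\<in>UNIV. cov2 M E (ric M E) t t k p)"
proof -
  have "E k p (scal M E) = (\<Sum>t\<in>UNIV. E k p (ric M E t t))"
    unfolding scal_def[abs_def] by (rule D_sum[OF p]) auto
  then show ?thesis
    unfolding cov2_def
    using \<Gamma>_trace[OF p, of k "\<lambda>t s. ric M E s t p"]
    by (simp add: sum_subtractf)
qed

lemma div_riem:
  assumes p: "p \<in> W"
  shows "(\<Sum>t\<in>UNIV. cov4 M E (riem M E) i t l k t p) = cov2 M E (ric M E) i l k p - cov2 M E (ric M E) i k l p"
proof -
  have "cov4 M E (riem M E) i t l k t p
      = cov4 M E (riem M E) i t l t k p - cov4 M E (riem M E) i t k t l p" for t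
    using bianchi2[OF p, of i t k t l] cov4_riem_antisym_right[OF p, of i t t l k] by simp
  then show ?thesis
    by (simp add: cov2_ric[OF p] sum_subtractf)
qed

text \<open>The trace of \<open>div_riem\<close> is the derivative of the scalar curvature minus the
  divergence of Ricci. Reversing both index pairs shows that the same double sum is that divergence,
  which therefore counts twice.\<close>

lemma div_ric:
  assumes p: "p \<in> W"
  shows "(\<Sum>t\<in>UNIV. cov2 M E (ric M E) t k t p) = E k p (scal M E) / 2"
proof -
  have "(\<Sum>i\<in>UNIV. \<Sum>t\<in>UNIV. cov4 M E (riem M E) i t i k t p)
      = E k p (scal M E) - (\<Sum>t\<in>UNIV. cov2 M E (ric M E) t k t p)"
    by (simp add: div_riem[OF p] sum_subtractf D_scal[OF p])
  moreover have "(\<Sum>i\<in>UNIV. \<Sum>t\<in>UNIV. cov4 M E (riem M E) i t i k t p)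
      = (\<Sum>t\<in>UNIV. \<Sum>i\<in>UNIV. cov4 M E (riem M E) t i k i t p)"
    by (subst sum.swap, intro sum.cong refl)
      (metis cov4_riem_antisym_right[OF p] cov4_riem_antisym_left[OF p] minus_minus)
  ultimately show ?thesis
    by (simp add: cov2_ric[OF p, symmetric])
qed

end

section \<open>Schouten, Cotton and Weyl tensors\<close>

text \<open>Here \<open>n\<close> is m - 1, \<open>k\<close> is m - 2 and the \<open>d\<close>s are
  Kronecker deltas. Each of the four Schouten factors carries half of a scalar curvature term, and
  the delta products agree in pairs, so the separate scalar term is absorbed. The derivative of the
  Weyl tensor then involves only the Riemann and Schouten tensors.\<close>

lemma weyl_schouten_algebra:
  fixes n k :: real
  shows "R - 1 / k * (a * d1 - b * d2 + c * d3 - e * d4) + s / (n * k) * (d3 * d1 - d4 * d2)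
    = R - 1 / k * ((a - s / (2 * n) * d3) * d1 - (b - s / (2 * n) * d4) * d2
      + ((c - s / (2 * n) * d1) * d3 - (e - s / (2 * n) * d2) * d4))"
proof -
  define u where "u = 1 / k"
  define v where "v = s / (2 * n)"
  have "s / (n * k) = 2 * v * u"
    by (simp add: u_def v_def)
  then show ?thesis
    unfolding u_def[symmetric] v_def[symmetric] by (simp add: algebra_simps)
qed

text \<open>Again \<open>n\<close> is m - 1 and \<open>k\<close> is m - 2, \<open>x - y\<close> is a
  Cotton component, and \<open>P\<close>, \<open>Q\<close> are derivatives of the scalar curvature.
  The latter cancel because the divergence of the Schouten tensor carries the factor
  \<open>k / (2 * n)\<close>; what is left is one Cotton tensor minus its \<open>k\<close>-th part,
  the origin of m - 3.\<close>

lemma div_weyl_algebra: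
  fixes n k :: real
  assumes "k \<noteq> 0"
  shows "x - y + (P * d1 - Q * d2) / (2 * n) - 1 / k * (x - k / (2 * n) * Q * d2 + (k / (2 * n) * P * d1 - y))
    = (k - 1) / k * (x - y)"
proof -
  define u where "u = 1 / (2 * n)"
  have "(P * d1 - Q * d2) / (2 * n) = u * (P * d1 - Q * d2)" "k / (2 * n) = k * u"
    by (simp_all add: u_def)
  then show ?thesis
    using assms by (simp only:) (simp add: field_simps)
qed

context ortho_frame
begin

lemma D_divide: "p \<in> W \<Longrightarrow> sm F \<Longrightarrow> E k p (\<lambda>q. F q / c) = E k p F / c"
  using D_cmult[of p F k "inverse c"] by (simp add: divide_inverse mult.commute)

lemma cov2_diff:
  assumes p: "p \<in> W" and X: "\<And>i j. sm (X i j)" and Y: "\<And>i j. sm (Y i j)"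
  shows "cov2 M E (\<lambda>i j q. X i j q - Y i j q) i j k p = cov2 M E X i j k p - cov2 M E Y i j k p"
  unfolding cov2_def by (simp add: D_diff[OF p X Y] right_diff_distrib sum_subtractf)

lemma schouten_eq: "schouten M E i j = (\<lambda>q. ric M E i j q - scal M E q / (2 * (real CARD('m) - 1)) * kd i j)"
  by (simp add: schouten_def fun_eq_iff)

lemma sm_schouten [intro!]: "sm (schouten M E i j)"
  unfolding schouten_eq by (intro sm_diff sm_mult sm_divide sm_ric sm_scal sm_const)

lemma schouten_sym: "p \<in> W \<Longrightarrow> schouten M E i j p = schouten M E j i p"
  by (simp add: schouten_def ric_sym[of p i j])

lemma cov2_schouten:
  assumes p: "p \<in> W"
  shows "cov2 M E (schouten M E) i j k p
    = cov2 M E (ric M E) i j k p - E k p (scal M E) / (2 * (real CARD('m) - 1)) * kd i j"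
proof -
  have "cov2 M E (schouten M E) = cov2 M E
      (\<lambda>i j q. ric M E i j q - scal M E q / (2 * (real CARD('m) - 1)) * kd i j)"
    by (simp add: schouten_eq[abs_def])
  then show ?thesis
    using cov2_diff[of p "ric M E" "\<lambda>i j q. scal M E q / (2 * (real CARD('m) - 1)) * kd i j" i j k,
        OF p sm_ric sm_mult[OF sm_divide[OF sm_scal] sm_const]]
      cov2_kd[of p "\<lambda>q. scal M E q / (2 * (real CARD('m) - 1))" i j k, OF p sm_divide[OF sm_scal]]
    by (simp only: D_divide[OF p sm_scal])
qed

lemma cov2_schouten_sym: "p \<in> W \<Longrightarrow> cov2 M E (schouten M E) i j k p = cov2 M E (schouten M E) j i k p"
  by (simp add: cov2_schouten cov2_ric_sym[of p i j])

lemma cotton_eq: "cotton M E i j k = (\<lambda>q. cov2 M E (schouten M E) i j k q - cov2 M E (schouten M E) i k j q)"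
  by (simp add: cotton_def fun_eq_iff)

lemma sm_cotton [intro!]: "sm (cotton M E i j k)"
  unfolding cotton_eq by auto

lemma cotton_cyclic: "p \<in> W \<Longrightarrow> cotton M E i j k p + cotton M E j k i p + cotton M E k i j p = 0"
  using cov2_schouten_sym[of p i j k] cov2_schouten_sym[of p i k j] cov2_schouten_sym[of p j k i]
  by (simp add: cotton_def)

lemma cov2_ric_antisym:
  assumes p: "p \<in> W"
  shows "cov2 M E (ric M E) i j k p - cov2 M E (ric M E) i k j p = cotton M E i j k p
    + (E k p (scal M E) * kd i j - E j p (scal M E) * kd i k) / (2 * (real CARD('m) - 1))"
  by (simp add: cotton_def cov2_schouten[OF p] diff_divide_distrib)

lemma div_schouten:
  assumes p: "p \<in> W" and m: "CARD('m) \<ge> 3"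
  shows "(\<Sum>t\<in>UNIV. cov2 M E (schouten M E) t k t p)
    = (real CARD('m) - 2) / (2 * (real CARD('m) - 1)) * E k p (scal M E)"
proof -
  have "(\<Sum>t\<in>UNIV. cov2 M E (schouten M E) t k t p)
      = E k p (scal M E) / 2 - E k p (scal M E) / (2 * (real CARD('m) - 1))"
    unfolding cov2_schouten[OF p] sum_subtractf div_ric[OF p] by (simp only: sum_kd)
  then show ?thesis
    using m by (simp add: field_simps)
qed

text \<open>The trace of the differentiated Schouten tensor and its divergence are the same multiple
  (m - 2) / (2 (m - 1)) of the differential of the scalar curvature.\<close>

lemma cotton_trace:
  assumes p: "p \<in> W" and m: "CARD('m) \<ge> 3"
  shows "(\<Sum>i\<in>UNIV. cotton M E i i k p) = 0"
proof -
  have "(\<Sum>i\<in>UNIV. cov2 M E (schouten M E) i i k p)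
      = E k p (scal M E) - real CARD('m) * (E k p (scal M E) / (2 * (real CARD('m) - 1)))"
    by (simp add: cov2_schouten[OF p] sum_subtractf D_scal[OF p])
  then show ?thesis
    unfolding cotton_def sum_subtractf div_schouten[OF p m] using m by (simp add: field_simps)
qed

text \<open>The Ricci identity for the Schouten tensor leaves the symmetric Hessian of the scalar
  curvature and curvature terms that are symmetric in the two free indices.\<close>

lemma div_cotton:
  assumes p: "p \<in> W" and m: "CARD('m) \<ge> 3"
  shows "(\<Sum>k\<in>UNIV. cov3 M E (cotton M E) k i j k p) = 0"
proof -
  define c where "c = (real CARD('m) - 2) / (2 * (real CARD('m) - 1))"
  let ?A = "schouten M E"
  let ?s = "scal M E p / (2 * (real CARD('m) - 1))"
  have C: "cov3 M E (cotton M E) k i j k p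
      = cov3 M E (cov2 M E ?A) k i j k p - cov3 M E (cov2 M E ?A) k j i k p" for k
    unfolding cotton_eq[abs_def] by (rule cov3_antisym[OF p]) auto
  have R: "cov3 M E (cov2 M E ?A) k i j k p = cov3 M E (cov2 M E ?A) k i k j p
      + (\<Sum>t\<in>UNIV. ?A t i p * riem M E t k j k p) + (\<Sum>t\<in>UNIV. ?A k t p * riem M E t i j k p)" for i j k
    using ricci_identity2[of p "schouten M E" k i j k, OF p sm_schouten] by simp
  have H: "(\<Sum>k\<in>UNIV. cov3 M E (cov2 M E ?A) k i k j p) = c * hess M E (scal M E) i j p" for i j
  proof -
    have "(\<Sum>k\<in>UNIV. cov3 M E (cov2 M E ?A) k i k j p)
        = cov1 M E (\<lambda>i q. \<Sum>h\<in>UNIV. cov2 M E ?A h i h q) i j p"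
      by (rule cov3_trace[OF p]) auto
    also have "\<dots> = cov1 M E (\<lambda>i q. c * E i q (scal M E)) i j p"
      unfolding cov1_def using D_cong[OF p, of "\<lambda>q. \<Sum>h\<in>UNIV. cov2 M E ?A h i h q"
          "\<lambda>q. c * E i q (scal M E)" j]
      by (simp add: div_schouten[OF _ m] p c_def sm_sum sm_cov2 sm_schouten)
    also have "\<dots> = c * hess M E (scal M E) i j p"
      unfolding cov1_def hess_def dfun_def[abs_def]
      by (simp add: D_cmult[OF p sm_D[OF sm_scal]] right_diff_distrib sum_distrib_left mult.left_commute)
    finally show ?thesis .
  qed
  have Q: "(\<Sum>k\<in>UNIV. \<Sum>t\<in>UNIV. ?A t i p * riem M E t k j k p)
      = (\<Sum>t\<in>UNIV. ric M E t i p * ric M E t j p) - ?s * ric M E i j p" for i j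
  proof -
    have "(\<Sum>k\<in>UNIV. \<Sum>t\<in>UNIV. ?A t i p * riem M E t k j k p) = (\<Sum>t\<in>UNIV. ?A t i p * ric M E t j p)"
      by (subst sum.swap) (simp add: ric_def sum_distrib_left)
    also have "\<dots> = (\<Sum>t\<in>UNIV. ric M E t i p * ric M E t j p) - (\<Sum>t\<in>UNIV. kd t i * (?s * ric M E t j p))"
      unfolding schouten_def sum_subtractf[symmetric] by (intro sum.cong refl) (simp add: algebra_simps)
    finally show ?thesis
      by (simp only: sum_kd)
  qed
  \<comment> \<open>Pair symmetry and skew-symmetry exchange \<open>i\<close> and \<open>j\<close>
    at the cost of exchanging the summation indices, which the symmetric Schouten tensor does not
    notice.\<close>
  have P: "(\<Sum>k\<in>UNIV. \<Sum>t\<in>UNIV. ?A k t p * riem M E t i j k p)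
      = (\<Sum>k\<in>UNIV. \<Sum>t\<in>UNIV. ?A k t p * riem M E t j i k p)" (is "?l = ?r")
  proof -
    have "riem M E t i j k p = riem M E k j i t p" for k t
      using riem_pair_sym[OF p, of t i j k] riem_antisym_left[OF p, of k j t i]
        riem_antisym_right[OF p, of k j i t] by simp
    then have "?l = (\<Sum>k\<in>UNIV. \<Sum>t\<in>UNIV. ?A t k p * riem M E k j i t p)"
      by (simp add: schouten_sym[OF p])
    also have "\<dots> = ?r"
      by (rule sum.swap)
    finally show ?thesis .
  qed
  show ?thesis
    unfolding C sum_subtractf R sum.distrib H Q P
    using hess_sym[OF p sm_scal, of i j] ric_sym[OF p, of i j] by (simp add: mult.commute)
qed

text \<open>By the cyclic identity the difference of the two sides is, up to sign, the divergence
  over the first index, which is zero by \<open>div_cotton\<close>.\<close>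

lemma div_cotton_sym:
  assumes p: "p \<in> W" and m: "CARD('m) \<ge> 3"
  shows "(\<Sum>k\<in>UNIV. cov3 M E (cotton M E) i j k k p) = (\<Sum>k\<in>UNIV. cov3 M E (cotton M E) j i k k p)"
proof -
  have "cotton M E i j k q - cotton M E j i k q = - cotton M E k i j q" if "q \<in> W" for i j k q
    using cotton_cyclic[OF that, of i j k] by (simp add: cotton_def)
  note e = this
  have "cov3 M E (cotton M E) i j k k p - cov3 M E (cotton M E) j i k k p = - cov3 M E (cotton M E) k i j k p" for k
  proof -
    have "cov3 M E (\<lambda>i j k q. cotton M E i j k q - cotton M E j i k q) i j k k p
        = cov3 M E (\<lambda>i j k q. - cotton M E k i j q) i j k k p"
      by (rule cov3_cong[OF p]) (auto intro: e)
    then show ?thesis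
      unfolding cov3_def
      by (simp add: D_diff[OF p] D_uminus[OF p] sm_cotton right_diff_distrib sum_subtractf sum_negf)
  qed
  then have "(\<Sum>k\<in>UNIV. cov3 M E (cotton M E) i j k k p) - (\<Sum>k\<in>UNIV. cov3 M E (cotton M E) j i k k p)
      = (\<Sum>k\<in>UNIV. - cov3 M E (cotton M E) k i j k p)"
    unfolding sum_subtractf[symmetric] by simp
  then show ?thesis
    using div_cotton[OF p m, of i j] by (simp add: sum_negf)
qed

section \<open>The Weyl tensor: derivative, divergence and trace\<close>

lemma weyl_eq:
  "weyl M E i j h t = (\<lambda>q. riem M E i j h t q - 1 / (real CARD('m) - 2) *
    (schouten M E i h q * kd j t - schouten M E i t q * kd j h
      + (schouten M E j t q * kd i h - schouten M E j h q * kd i t)))"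
  unfolding weyl_def schouten_def Let_def by (intro ext weyl_schouten_algebra)

lemma sm_weyl: "sm (weyl M E i j h t)"
  unfolding weyl_eq by (intro sm_diff sm_add sm_mult sm_const sm_riem sm_schouten)

lemma cov4_weyl:
  assumes p: "p \<in> W"
  shows "cov4 M E (weyl M E) i j h t k p = cov4 M E (riem M E) i j h t k p - 1 / (real CARD('m) - 2) *
    (cov2 M E (schouten M E) i h k p * kd j t - cov2 M E (schouten M E) i t k p * kd j h
      + (cov2 M E (schouten M E) j t k p * kd i h - cov2 M E (schouten M E) j h k p * kd i t))"
proof -
  \<comment> \<open>All four Schouten terms of the Weyl tensor are this array with permuted indices,
    so one derivative formula serves them all.\<close>
  define Z where "Z i j h t q = schouten M E i h q * kd j t" for i j h t :: 'm and q
  have Z: "sm (Z i j h t)" for i j h t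
    unfolding Z_def[abs_def] by (intro sm_mult sm_schouten sm_const)
  have K: "cov4 M E Z i j h t k p = cov2 M E (schouten M E) i h k p * kd j t" for i j h t
    unfolding Z_def[abs_def] by (rule cov4_kd[OF p sm_schouten])
  have w: "weyl M E i j h t = (\<lambda>q. riem M E i j h t q - 1 / (real CARD('m) - 2) *
      (Z i j h t q - Z i j t h q + (Z j i t h q - Z j i h t q)))" for i j h t
    unfolding Z_def by (rule weyl_eq)
  have D: "E k p (weyl M E i j h t) = E k p (riem M E i j h t) - 1 / (real CARD('m) - 2) *
      (E k p (Z i j h t) - E k p (Z i j t h) + (E k p (Z j i t h) - E k p (Z j i h t)))"
    unfolding w by (simp only: D_diff[OF p] D_add[OF p] D_cmult[OF p] sm_diff sm_add sm_mult sm_const sm_riem Z)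
  have S: "(\<Sum>l\<in>UNIV. \<Gamma> k a l p * (R l - c * (z1 l - z2 l + (z3 l - z4 l))))
      = (\<Sum>l\<in>UNIV. \<Gamma> k a l p * R l) - c * ((\<Sum>l\<in>UNIV. \<Gamma> k a l p * z1 l) - (\<Sum>l\<in>UNIV. \<Gamma> k a l p * z2 l)
        + ((\<Sum>l\<in>UNIV. \<Gamma> k a l p * z3 l) - (\<Sum>l\<in>UNIV. \<Gamma> k a l p * z4 l)))" for a R c z1 z2 z3 z4
    unfolding sum_distrib_left sum_subtractf[symmetric] sum.distrib[symmetric]
    by (intro sum.cong refl) (simp add: algebra_simps)
  have "cov4 M E (weyl M E) i j h t k p = cov4 M E (riem M E) i j h t k p - 1 / (real CARD('m) - 2) *
      (cov4 M E Z i j h t k p - cov4 M E Z i j t h k p + (cov4 M E Z j i t h k p - cov4 M E Z j i h t k p))"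
    unfolding cov4_def D unfolding w S by (simp only: algebra_simps)
  then show ?thesis unfolding K .
qed

lemma div_weyl:
  assumes p: "p \<in> W" and m: "CARD('m) \<ge> 3"
  shows "(\<Sum>k\<in>UNIV. cov4 M E (weyl M E) t i j k k p)
    = (real CARD('m) - 3) / (real CARD('m) - 2) * cotton M E j t i p"
proof -
  let ?A = "cov2 M E (schouten M E)" and ?a = "1 / (real CARD('m) - 2)"
  \<comment> \<open>Pair symmetry brings the divergence index into the second place, where
    \<open>div_riem\<close> applies.\<close>
  have "(\<Sum>k\<in>UNIV. cov4 M E (riem M E) t i j k k p) = (\<Sum>k\<in>UNIV. cov4 M E (riem M E) j k t i k p)"
    by (simp add: cov4_riem_pair_sym[OF p, of t i j])
  also have "\<dots> = cov2 M E (ric M E) j t i p - cov2 M E (ric M E) j i t p"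
    by (rule div_riem[OF p])
  finally have R: "(\<Sum>k\<in>UNIV. cov4 M E (riem M E) t i j k k p) = cotton M E j t i p
      + (E i p (scal M E) * kd j t - E t p (scal M E) * kd j i) / (2 * (real CARD('m) - 1))"
    unfolding cov2_ric_antisym[OF p] .
  have T: "(\<Sum>k\<in>UNIV. ?A s k k p) = (real CARD('m) - 2) / (2 * (real CARD('m) - 1)) * E s p (scal M E)" for s
    unfolding div_schouten[OF p m, symmetric] by (simp add: cov2_schouten_sym[OF p, of s])
  have "(\<Sum>k\<in>UNIV. cov4 M E (weyl M E) t i j k k p) = (\<Sum>k\<in>UNIV. cov4 M E (riem M E) t i j k k p)
      - ?a * ((\<Sum>k\<in>UNIV. ?A t j k p * kd i k) - (\<Sum>k\<in>UNIV. ?A t k k p) * kd i j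
        + ((\<Sum>k\<in>UNIV. ?A i k k p) * kd t j - (\<Sum>k\<in>UNIV. ?A i j k p * kd t k)))"
    unfolding cov4_weyl[OF p] by (simp only: sum_subtractf sum.distrib sum_distrib_left[symmetric] sum_distrib_right[symmetric])
  also have "\<dots> = (real CARD('m) - 3) / (real CARD('m) - 2) * cotton M E j t i p"
    using div_weyl_algebra[of "real CARD('m) - 2" "?A j t i p" "?A j i t p" "E i p (scal M E)" "kd j t"
        "E t p (scal M E)" "kd j i" "real CARD('m) - 1"] m
    unfolding R T sum_kd cotton_def
    by (simp only: cov2_schouten_sym[OF p, of t j] cov2_schouten_sym[OF p, of i j] eq_commute[of t j] eq_commute[of i j])
      simp
  finally show ?thesis .
qed

lemma weyl_trace:
  assumes m: "CARD('m) \<ge> 3"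
  shows "(\<Sum>t\<in>UNIV. weyl M E i t j t p) = 0"
proof -
  define u where "u = 1 / (real CARD('m) - 2)"
  define v where "v = scal M E p / ((real CARD('m) - 1) * (real CARD('m) - 2))"
  have "weyl M E i t j t p = riem M E i t j t p - u * ric M E i j p + u * (ric M E i t p * kd t j)
      - u * kd i j * ric M E t t p + u * (kd i t * ric M E t j p) + v * kd i j - v * (kd i t * kd t j)" for t
    unfolding weyl_def Let_def u_def[symmetric] v_def[symmetric]
    by (simp add: algebra_simps split del: if_split)
  then have "(\<Sum>t\<in>UNIV. weyl M E i t j t p) = ric M E i j p - real CARD('m) * (u * ric M E i j p) + u * ric M E i j p
      - u * kd i j * scal M E p + u * ric M E i j p + real CARD('m) * (v * kd i j) - v * kd i j"
    unfolding scal_def by (simp only: sum.distrib sum_subtractf sum_distrib_left[symmetric] sum_kd sum_constant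
        ric_def[of M E i j p, symmetric]) simp
  also have "\<dots> = ric M E i j p * (1 - u * (real CARD('m) - 2)) + kd i j * (v * (real CARD('m) - 1) - u * scal M E p)"
    by (simp add: algebra_simps split del: if_split)
  also have "\<dots> = 0"
    using m by (simp add: u_def v_def)
  finally show ?thesis .
qed

lemma weyl_antisym:
  assumes p: "p \<in> W"
  shows "weyl M E j i k t p = - weyl M E i j k t p"
  unfolding weyl_def Let_def riem_antisym_left[OF p, of j i] by (simp add: algebra_simps)

end

section \<open>Integrability conditions\<close>

text \<open>With \<open>k\<close> = m - 2 and \<open>n\<close> = m - 1, \<open>a\<close> and
  \<open>b\<close> are the deltas for ij and ik, \<open>F\<close> is f_t R_tijk, \<open>hj\<close>,
  \<open>hk\<close> are f_ij, f_ik, \<open>Rj\<close>, \<open>Rk\<close> are R_ij, R_ik, and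
  \<open>rj\<close>, \<open>rk\<close> are f_t R_tj, f_t R_tk. After substitution the terms with
  \<open>L\<close> cancel between the Hessian and \<open>U\<close>, and the cubic terms in the
  differential cancel by skew-symmetry.\<close>

lemma integrability_algebra:
  fixes \<beta> k n :: real
  assumes "\<beta> \<noteq> 0" "k \<noteq> 0" "n \<noteq> 0" "n = k + 1"
    and C: "\<alpha> * C + \<beta> * F + \<mu> * (hk * fj - hj * fk) = Uk * a - Uj * b"
    and hk: "\<beta> * hk = L * b - \<alpha> * Rk - \<mu> * (fi * fk)"
    and hj: "\<beta> * hj = L * a - \<alpha> * Rj - \<mu> * (fi * fj)"
    and Uk: "\<beta> * (n * Uk) = - (\<beta> * \<beta> * rk) - \<mu> * (n * L * fk + \<alpha> * (rk - S * fk))"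
    and Uj: "\<beta> * (n * Uj) = - (\<beta> * \<beta> * rj) - \<mu> * (n * L * fj + \<alpha> * (rj - S * fj))"
  shows "\<alpha> * C + \<beta> * (F - 1 / k * (rj * b - rk * a + Rk * fj - Rj * fk) + S / (n * k) * (fj * b - fk * a))
    = (\<beta> - k * \<alpha> * \<mu> / \<beta>) * (1 / k * (fk * Rj - fj * Rk) + 1 / (n * k) * (rk * a - rj * b)
        - S / (n * k) * (fk * a - fj * b))"
proof -
  \<comment> \<open>Reciprocals become variables, so the goal turns polynomial. Since
    \<open>n = k + 1\<close>, the mixed coefficient \<open>1 / (n * k)\<close> is
    \<open>x - y\<close>, and multiplying it by \<open>k\<close> gives \<open>y\<close>.\<close>
  define x y w where "x = 1 / k" and "y = 1 / n" and "w = 1 / \<beta>"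
  have xy: "1 / (n * k) = x - y"
    using assms(2-4) by (simp add: x_def y_def field_simps)
  have S: "S / (n * k) = S * (x - y)"
    using xy by (simp add: divide_inverse)
  have c1: "k * x = 1" and c2: "n * y = 1" and c3: "\<beta> * w = 1"
    using assms by (simp_all add: x_def y_def w_def)
  have hk': "hk = w * (L * b - \<alpha> * Rk - \<mu> * (fi * fk))"
    and hj': "hj = w * (L * a - \<alpha> * Rj - \<mu> * (fi * fj))"
    using hk hj assms(1) by (simp_all add: w_def field_simps)
  have U: "U = - (\<beta> * y * r) - \<mu> * w * (L * g + y * (\<alpha> * (r - S * g)))"
    if "\<beta> * (n * U) = - (\<beta> * \<beta> * r) - \<mu> * (n * L * g + \<alpha> * (r - S * g))" for U r g
  proof -
    have "U = (y * n) * (w * \<beta>) * U"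
      using c2 c3 by (simp add: mult.commute)
    also have "\<dots> = y * w * (\<beta> * (n * U))"
      by simp
    also have "\<dots> = - ((\<beta> * w) * \<beta> * y * r) - \<mu> * w * ((n * y) * L * g + y * (\<alpha> * (r - S * g)))"
      unfolding that by (simp add: algebra_simps)
    finally show ?thesis
      unfolding c2 c3 by simp
  qed
  have c4: "k * (x - y) = y"
    using c1 c2 assms(4) by (simp add: algebra_simps)
  have D: "(\<beta> - k * \<alpha> * \<mu> / \<beta>) * (x * X + (x - y) * Y - S * (x - y) * Z)
      = \<beta> * (x * X + (x - y) * Y - S * (x - y) * Z) - \<alpha> * \<mu> * w * (X + y * Y - S * y * Z)" for X Y Z
  proof -
    have "(\<beta> - k * \<alpha> * \<mu> / \<beta>) * (x * X + (x - y) * Y - S * (x - y) * Z)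
      = \<beta> * (x * X + (x - y) * Y - S * (x - y) * Z)
        - \<alpha> * \<mu> * w * ((k * x) * X + (k * (x - y)) * Y - S * (k * (x - y)) * Z)"
      by (simp add: w_def divide_inverse algebra_simps)
    then show ?thesis
      unfolding c1 c4 by simp
  qed
  have "\<alpha> * C = Uk * a - Uj * b - \<beta> * F - \<mu> * (hk * fj - hj * fk)"
    using C by simp
  then show ?thesis
    unfolding xy S x_def[symmetric] D unfolding U[OF Uk] U[OF Uj] hk' hj'
    by (simp add: algebra_simps)
qed

text \<open>\<open>L\<close> stands for the whole factor \<rho> S + \<lambda> of the metric; its
  differential is later absorbed into the one-form \<open>U\<close> and eliminated.\<close>

locale einstein_frame = ortho_frame M W E
  for M :: "('a, 'm::finite) rmanifold" and W E +
  fixes f L :: "'a \<Rightarrow> real" and \<alpha> \<beta> \<mu> :: real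
  assumes dim: "CARD('m) \<ge> 3" and beta: "\<beta> \<noteq> 0" and sm_f: "sm f" and sm_L: "sm L"
    and einstein: "\<And>p i j. p \<in> W \<Longrightarrow>
      \<alpha> * ric M E i j p + \<beta> * hess M E f i j p + \<mu> * (dfun E f i p * dfun E f j p) = L p * kd i j"
begin

lemma beta_hess: "p \<in> W \<Longrightarrow> \<beta> * hess M E f i j p
    = L p * kd i j - \<alpha> * ric M E i j p - \<mu> * (dfun E f i p * dfun E f j p)"
  using einstein[of p i j] by (simp only: algebra_simps)

lemma cov2_einstein:
  assumes p: "p \<in> W"
  shows "\<alpha> * cov2 M E (ric M E) i j k p + \<beta> * cov2 M E (hess M E f) i j k p
    + \<mu> * (hess M E f i k p * dfun E f j p + dfun E f i p * hess M E f j k p) = E k p L * kd i j"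
proof -
  have "cov2 M E (\<lambda>i j q. L q * kd i j) i j k p
      = cov2 M E (\<lambda>i j q. \<alpha> * ric M E i j q + \<beta> * hess M E f i j q + \<mu> * (dfun E f i q * dfun E f j q)) i j k p"
    by (rule cov2_cong[OF p]) (auto simp only: einstein intro!: sm_mult sm_L)
  also have "\<dots> = \<alpha> * cov2 M E (ric M E) i j k p + \<beta> * cov2 M E (hess M E f) i j k p
      + \<mu> * cov2 M E (\<lambda>i j q. dfun E f i q * dfun E f j q) i j k p"
    unfolding cov2_def
    by (simp add: D_add[OF p] D_cmult[OF p] sm_add sm_mult sm_const sm_ric sm_hess sm_dfun sm_f
        distrib_left sum.distrib sum_distrib_left right_diff_distrib mult.left_commute)
  finally show ?thesis
    unfolding cov2_kd[OF p sm_L] cov2_mult[OF p sm_dfun[OF sm_f]] hess_def by simp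
qed

text \<open>The unknown one-form of the skew-symmetrised equation: the differential of
  \<open>L\<close>, corrected by the scalar curvature term that arises when the Ricci derivatives
  are replaced by the Cotton tensor.\<close>

definition U :: "'m \<Rightarrow> 'a \<Rightarrow> real" where
  "U k p = E k p L - \<alpha> * E k p (scal M E) / (2 * (real CARD('m) - 1))"

lemma cotton_riem:
  assumes p: "p \<in> W"
  shows "\<alpha> * cotton M E i j k p + \<beta> * (\<Sum>t\<in>UNIV. dfun E f t p * riem M E t i j k p)
    + \<mu> * (hess M E f i k p * dfun E f j p - hess M E f i j p * dfun E f k p)
    = U k p * kd i j - U j p * kd i k"
proof -
  have r: "(\<Sum>t\<in>UNIV. dfun E f t p * riem M E t i j k p)
      = cov2 M E (hess M E f) i j k p - cov2 M E (hess M E f) i k j p"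
    unfolding hess_def by (rule ricci_identity1[OF p sm_dfun[OF sm_f], symmetric])
  have u: "U k p * kd i j - U j p * kd i k = E k p L * kd i j - E j p L * kd i k
      - \<alpha> * ((E k p (scal M E) * kd i j - E j p (scal M E) * kd i k) / (2 * (real CARD('m) - 1)))"
    unfolding U_def left_diff_distrib diff_divide_distrib right_diff_distrib
      times_divide_eq_left times_divide_eq_right mult.assoc by simp
  \<comment> \<open>The products of \<open>dfun E f i\<close> with the Hessian in \<open>j\<close>,
    \<open>k\<close> drop out because the Hessian is symmetric.\<close>
  show ?thesis
    unfolding u r using cov2_einstein[OF p, of i j k] cov2_einstein[OF p, of i k j] cov2_ric_antisym[OF p, of i j k]
      hess_sym[OF p sm_f, of j k]
    by (simp add: algebra_simps split del: if_split)
qed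

text \<open>The trace of \<open>cotton_riem\<close> over i = j gives m - 1 copies of
  \<open>U\<close>. Multiplying by \<beta> allows the Hessian to be replaced through the equation;
  the squared length of the differential then cancels between the contraction of the Hessian with
  the differential and the trace of the Hessian.\<close>

lemma U_eq:
  assumes p: "p \<in> W"
  shows "\<beta> * ((real CARD('m) - 1) * U k p) = - (\<beta> * \<beta> * (\<Sum>t\<in>UNIV. dfun E f t p * ric M E t k p))
    - \<mu> * ((real CARD('m) - 1) * L p * dfun E f k p
      + \<alpha> * ((\<Sum>t\<in>UNIV. dfun E f t p * ric M E t k p) - scal M E p * dfun E f k p))"
proof -
  let ?f = "\<lambda>i. dfun E f i p" and ?r = "\<Sum>t\<in>UNIV. dfun E f t p * ric M E t k p"
  have R: "(\<Sum>i\<in>UNIV. \<Sum>t\<in>UNIV. ?f t * riem M E t i i k p) = - ?r"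
  proof -
    have "(\<Sum>i\<in>UNIV. riem M E t i i k p) = - ric M E t k p" for t
      unfolding ric_def sum_negf[symmetric] by (intro sum.cong refl riem_antisym_right[OF p])
    then show ?thesis
      by (subst sum.swap) (simp add: sum_distrib_left[symmetric] sum_negf)
  qed
  have "(\<Sum>i\<in>UNIV. \<alpha> * cotton M E i i k p + \<beta> * (\<Sum>t\<in>UNIV. ?f t * riem M E t i i k p)
      + \<mu> * (hess M E f i k p * ?f i - hess M E f i i p * ?f k))
      = (\<Sum>i\<in>UNIV. U k p * 1 - U i p * kd i k)"
    unfolding cotton_riem[OF p] by simp
  then have 1: "- \<beta> * ?r + \<mu> * ((\<Sum>i\<in>UNIV. hess M E f i k p * ?f i) - (\<Sum>i\<in>UNIV. hess M E f i i p) * ?f k)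
      = (real CARD('m) - 1) * U k p"
    unfolding sum.distrib sum_subtractf sum_distrib_left[symmetric] sum_distrib_right[symmetric]
      cotton_trace[OF p dim] R sum_kd by (simp add: algebra_simps)
  have "\<beta> * (\<Sum>i\<in>UNIV. hess M E f i k p * ?f i)
      = (\<Sum>i\<in>UNIV. L p * (kd i k * ?f i) - \<alpha> * (?f i * ric M E i k p) - \<mu> * (?f i * ?f i * ?f k))"
    unfolding sum_distrib_left mult.assoc[symmetric] beta_hess[OF p]
    by (intro sum.cong refl) (simp add: algebra_simps split del: if_split)
  then have 2: "\<beta> * (\<Sum>i\<in>UNIV. hess M E f i k p * ?f i)
      = L p * ?f k - \<alpha> * ?r - \<mu> * ((\<Sum>i\<in>UNIV. ?f i * ?f i) * ?f k)"
    unfolding sum.distrib sum_subtractf sum_distrib_left[symmetric] sum_distrib_right[symmetric] sum_kd .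
  have 3: "\<beta> * (\<Sum>i\<in>UNIV. hess M E f i i p)
      = real CARD('m) * L p - \<alpha> * scal M E p - \<mu> * (\<Sum>i\<in>UNIV. ?f i * ?f i)"
    unfolding sum_distrib_left beta_hess[OF p] scal_def by (simp add: sum_subtractf)
  have "\<beta> * ((real CARD('m) - 1) * U k p) = - (\<beta> * \<beta> * ?r)
      + \<mu> * (\<beta> * (\<Sum>i\<in>UNIV. hess M E f i k p * ?f i) - (\<beta> * (\<Sum>i\<in>UNIV. hess M E f i i p)) * ?f k)"
    unfolding 1[symmetric] by (simp add: algebra_simps)
  then show ?thesis
    unfolding 2 3 by (simp add: algebra_simps)
qed

lemma integrability1:
  assumes p: "p \<in> W"
  shows "\<alpha> * cotton M E i j k p + \<beta> * (\<Sum>t\<in>UNIV. dfun E f t p * weyl M E t i j k p)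
    = (\<beta> - (real CARD('m) - 2) * \<alpha> * \<mu> / \<beta>) * dtensor M E f i j k p"
proof -
  let ?f = "\<lambda>i. dfun E f i p" and ?r = "\<lambda>k. \<Sum>t\<in>UNIV. dfun E f t p * ric M E t k p"
  define u where "u = 1 / (real CARD('m) - 2)"
  define v where "v = scal M E p / ((real CARD('m) - 1) * (real CARD('m) - 2))"
  have "?f t * weyl M E t i j k p = ?f t * riem M E t i j k p - u * (?f t * ric M E t j p * kd i k
      - ?f t * ric M E t k p * kd i j + ric M E i k p * (?f t * kd t j) - ric M E i j p * (?f t * kd t k))
      + v * (?f t * kd t j * kd i k - ?f t * kd t k * kd i j)" for t
    unfolding weyl_def Let_def u_def[symmetric] v_def[symmetric]
    by (simp add: algebra_simps split del: if_split)
  then have 1: "(\<Sum>t\<in>UNIV. ?f t * weyl M E t i j k p) = (\<Sum>t\<in>UNIV. ?f t * riem M E t i j k p)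
      - u * (?r j * kd i k - ?r k * kd i j + ric M E i k p * ?f j - ric M E i j p * ?f k)
      + v * (?f j * kd i k - ?f k * kd i j)"
    by (simp only: sum.distrib sum_subtractf sum_distrib_left[symmetric] sum_distrib_right[symmetric] sum_kd)
  have "(\<Sum>t\<in>UNIV. ?f t * (ric M E t k p * kd i j - ric M E t j p * kd i k)) = ?r k * kd i j - ?r j * kd i k"
    unfolding right_diff_distrib mult.assoc[symmetric] sum_subtractf sum_distrib_right[symmetric] ..
  then have 2: "dtensor M E f i j k p = 1 / (real CARD('m) - 2) * (?f k * ric M E i j p - ?f j * ric M E i k p)
      + 1 / ((real CARD('m) - 1) * (real CARD('m) - 2)) * (?r k * kd i j - ?r j * kd i k)
      - scal M E p / ((real CARD('m) - 1) * (real CARD('m) - 2)) * (?f k * kd i j - ?f j * kd i k)"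
    unfolding dtensor_def Let_def by simp
  show ?thesis
    unfolding 1 2 u_def v_def using dim
    by (intro integrability_algebra[OF beta _ _ _ cotton_riem[OF p] beta_hess[OF p] beta_hess[OF p]
          U_eq[OF p] U_eq[OF p]]) simp_all
qed

lemma sm_dtensor: "sm (dtensor M E f i j k)"
  unfolding dtensor_def[abs_def] Let_def
  by (intro sm_diff sm_add sm_mult sm_divide sm_sum sm_const sm_dfun sm_ric sm_scal sm_f)

lemma integrability2:
  assumes p: "p \<in> W"
  shows "\<alpha> * bach M E i j p
    = 1 / (real CARD('m) - 2) *
      ((\<beta> - (real CARD('m) - 2) * \<alpha> * \<mu> / \<beta>) * (\<Sum>k\<in>UNIV. cov3 M E (dtensor M E f) i j k k p)
       + \<beta> * ((real CARD('m) - 3) / (real CARD('m) - 2)) * (\<Sum>t\<in>UNIV. dfun E f t p * cotton M E j i t p)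
       - \<mu> * (\<Sum>t\<in>UNIV. \<Sum>k\<in>UNIV. dfun E f t p * dfun E f k p * weyl M E i t j k p))"
proof -
  define c where "c = \<beta> - (real CARD('m) - 2) * \<alpha> * \<mu> / \<beta>"
  let ?f = "\<lambda>i. dfun E f i p"
  let ?Z = "\<lambda>i j k q. \<Sum>t\<in>UNIV. dfun E f t q * weyl M E t i j k q"
  let ?R = "\<Sum>k\<in>UNIV. \<Sum>t\<in>UNIV. ric M E k t p * weyl M E i k j t p"
  let ?F = "\<Sum>t\<in>UNIV. \<Sum>k\<in>UNIV. ?f t * ?f k * weyl M E i t j k p"
  let ?C = "\<Sum>t\<in>UNIV. ?f t * cotton M E j i t p"
  have smZ: "sm (?Z i j k)" for i j k
    by (intro sm_sum sm_mult sm_dfun sm_weyl sm_f)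
  \<comment> \<open>The first condition holds at all points of \<open>W\<close>, hence may be
    differentiated covariantly.\<close>
  have "\<alpha> * cov3 M E (cotton M E) i j k k p + \<beta> * cov3 M E ?Z i j k k p = c * cov3 M E (dtensor M E f) i j k k p" for k
  proof -
    have "cov3 M E (\<lambda>i j k q. \<alpha> * cotton M E i j k q + \<beta> * ?Z i j k q) i j k k p
        = cov3 M E (\<lambda>i j k q. c * dtensor M E f i j k q) i j k k p"
      unfolding c_def
      by (rule cov3_cong[OF p]) (auto simp only: integrability1 intro!: sm_mult sm_dtensor sm_add smZ)
    moreover have "cov3 M E (\<lambda>i j k q. \<alpha> * cotton M E i j k q + \<beta> * ?Z i j k q) i j k k p
        = \<alpha> * cov3 M E (cotton M E) i j k k p + \<beta> * cov3 M E ?Z i j k k p"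
    proof -
      have "E k p (\<lambda>q. \<alpha> * cotton M E i j k q + \<beta> * ?Z i j k q) = \<alpha> * E k p (cotton M E i j k) + \<beta> * E k p (?Z i j k)"
        by (simp only: D_add[OF p] D_cmult[OF p] sm_mult sm_const sm_cotton smZ)
      moreover have "(\<Sum>l\<in>UNIV. g l * (\<alpha> * x l + \<beta> * y l)) = \<alpha> * (\<Sum>l\<in>UNIV. g l * x l) + \<beta> * (\<Sum>l\<in>UNIV. g l * y l)"
        for g x y :: "'m \<Rightarrow> real"
        by (simp add: sum_distrib_left sum.distrib algebra_simps)
      ultimately show ?thesis
        unfolding cov3_def by (simp only: right_diff_distrib)
    qed
    moreover have "cov3 M E (\<lambda>i j k q. c * dtensor M E f i j k q) i j k k p = c * cov3 M E (dtensor M E f) i j k k p"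
      unfolding cov3_def
      by (simp add: D_cmult[OF p sm_dtensor] right_diff_distrib sum_distrib_left mult.left_commute)
    ultimately show ?thesis by simp
  qed
  note 0 = this
  \<comment> \<open>Here the first two Cotton indices are exchanged to match the order in
    \<open>bach\<close>.\<close>
  have 1: "\<alpha> * (\<Sum>k\<in>UNIV. cov3 M E (cotton M E) j i k k p) + \<beta> * (\<Sum>k\<in>UNIV. cov3 M E ?Z i j k k p)
      = c * (\<Sum>k\<in>UNIV. cov3 M E (dtensor M E f) i j k k p)"
    unfolding div_cotton_sym[OF p dim, of j i] sum_distrib_left sum.distrib[symmetric] 0 ..
  have swap: "(\<Sum>k\<in>UNIV. \<Sum>t\<in>UNIV. ?f t * cov4 M E (weyl M E) t i j k k p)
      = (\<Sum>t\<in>UNIV. ?f t * (\<Sum>k\<in>UNIV. cov4 M E (weyl M E) t i j k k p))"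
    by (subst sum.swap) (simp only: sum_distrib_left)
  have "cov3 M E ?Z i j k k p = (\<Sum>t\<in>UNIV. hess M E f t k p * weyl M E t i j k p)
      + (\<Sum>t\<in>UNIV. ?f t * cov4 M E (weyl M E) t i j k k p)" for k
    using cov3_contract[of p "dfun E f" "weyl M E" i j k k] p sm_dfun[OF sm_f] sm_weyl
    by (simp add: hess_def)
  then have "(\<Sum>k\<in>UNIV. cov3 M E ?Z i j k k p) = (\<Sum>k\<in>UNIV. \<Sum>t\<in>UNIV. hess M E f t k p * weyl M E t i j k p)
      + (\<Sum>t\<in>UNIV. ?f t * (\<Sum>k\<in>UNIV. cov4 M E (weyl M E) t i j k k p))"
    by (simp only: sum.distrib swap)
  \<comment> \<open>The minus sign comes from exchanging the last two indices of the Cotton tensor,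
    \<open>cotton M E j t i\<close> to \<open>cotton M E j i t\<close>.\<close>
  also have "(\<Sum>t\<in>UNIV. ?f t * (\<Sum>k\<in>UNIV. cov4 M E (weyl M E) t i j k k p))
      = - ((real CARD('m) - 3) / (real CARD('m) - 2) * ?C)"
    unfolding div_weyl[OF p dim] sum_distrib_left sum_negf[symmetric]
    by (intro sum.cong refl) (simp add: cotton_def[of M E j] algebra_simps)
  finally have 2: "(\<Sum>k\<in>UNIV. cov3 M E ?Z i j k k p)
      = (\<Sum>k\<in>UNIV. \<Sum>t\<in>UNIV. hess M E f t k p * weyl M E t i j k p)
        - (real CARD('m) - 3) / (real CARD('m) - 2) * ?C"
    by simp
  \<comment> \<open>Swapping the first pair of Weyl indices flips every sign, so the Ricci part
    appears exactly as in the Bach tensor. The part with \<open>kd\<close> becomes the trace of the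
    Weyl tensor and vanishes on summation.\<close>
  have "\<beta> * (hess M E f t k p * weyl M E t i j k p) = - (L p * (kd t k * weyl M E i t j k p))
      + \<alpha> * (ric M E t k p * weyl M E i t j k p) + \<mu> * (?f t * ?f k * weyl M E i t j k p)" for t k
    unfolding mult.assoc[symmetric] beta_hess[OF p] weyl_antisym[OF p, of t i]
    by (simp add: algebra_simps split del: if_split)
  then have "\<beta> * (\<Sum>t\<in>UNIV. \<Sum>k\<in>UNIV. hess M E f t k p * weyl M E t i j k p) = \<alpha> * ?R + \<mu> * ?F"
    by (simp only: sum_distrib_left[of \<beta>] sum.distrib sum_negf sum_distrib_left[of "L p", symmetric]
        sum_distrib_left[of \<alpha>, symmetric] sum_distrib_left[of \<mu>, symmetric] sum_kd weyl_trace[OF dim] mult_zero_right minus_zero add_0_left)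
  then have 3: "\<beta> * (\<Sum>k\<in>UNIV. \<Sum>t\<in>UNIV. hess M E f t k p * weyl M E t i j k p) = \<alpha> * ?R + \<mu> * ?F"
    by (subst sum.swap)
  have "\<alpha> * bach M E i j p = 1 / (real CARD('m) - 2) * (\<alpha> * (\<Sum>k\<in>UNIV. cov3 M E (cotton M E) j i k k p) + \<alpha> * ?R)"
    unfolding bach_def by (simp add: algebra_simps)
  moreover have "\<alpha> * (\<Sum>k\<in>UNIV. cov3 M E (cotton M E) j i k k p) + \<alpha> * ?R
      = c * (\<Sum>k\<in>UNIV. cov3 M E (dtensor M E f) i j k k p)
        + \<beta> * ((real CARD('m) - 3) / (real CARD('m) - 2)) * ?C - \<mu> * ?F"
    using 1 3 unfolding 2 right_diff_distrib mult.assoc by linarith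
  ultimately show ?thesis
    unfolding c_def by simp
qed

end

theorem theorem6p4:
  fixes M :: "('a, 'm::finite) rmanifold"
    and f lam :: "'a \<Rightarrow> real"
    and \<alpha> \<beta> \<mu> \<rho> :: real
    and W :: "'a set"
    and E :: "('a, 'm) frame"
    and p :: 'a
  assumes "riemannian_manifold M"
    and "levi_civita M"
    and "connected_space (mf_top M)"
    and "CARD('m) \<ge> 3"
    and "gradient_einstein_type M f lam \<alpha> \<beta> \<mu> \<rho>"
    and "\<beta> \<noteq> 0"
    and "orthonormal_frame M W E"
    and "p \<in> W"
  shows "(\<forall>i j k.
            \<alpha> * cotton M E i j k p + \<beta> * (\<Sum>t\<in>UNIV. dfun E f t p * weyl M E t i j k p)
              = (\<beta> - (real CARD('m) - 2) * \<alpha> * \<mu> / \<beta>) * dtensor M E f i j k p) \<and>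
         (\<forall>i j.
            \<alpha> * bach M E i j p
              = 1 / (real CARD('m) - 2) *
                ((\<beta> - (real CARD('m) - 2) * \<alpha> * \<mu> / \<beta>)
                   * (\<Sum>k\<in>UNIV. cov3 M E (dtensor M E f) i j k k p)
                 + \<beta> * ((real CARD('m) - 3) / (real CARD('m) - 2))
                   * (\<Sum>t\<in>UNIV. dfun E f t p * cotton M E j i t p)
                 - \<mu> * (\<Sum>t\<in>UNIV. \<Sum>k\<in>UNIV. dfun E f t p * dfun E f k p * weyl M E i t j k p)))"
proof -
  interpret ortho_frame M W E
    using assms by unfold_locales
  have sub: "W \<subseteq> topspace (mf_top M)"
    using W_topspace by auto
  have g: "smooth_fun M (topspace (mf_top M)) f" "smooth_fun M (topspace (mf_top M)) lam"
    "\<And>q i j. q \<in> W \<Longrightarrow> \<alpha> * ric M E i j q + \<beta> * hess M E f i j q + \<mu> * (dfun E f i q * dfun E f j q)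
          = (\<rho> * scal M E q + lam q) * kd i j"
    using assms(5,7) unfolding gradient_einstein_type_def by blast+
  interpret einstein_frame M W E f "\<lambda>q. \<rho> * scal M E q + lam q" \<alpha> \<beta> \<mu>
    using assms(4,6) smooth_fun_subset[OF g(1) sub] smooth_fun_subset[OF g(2) sub] g(3)
    by unfold_locales (auto intro!: sm_add sm_mult)
  show ?thesis
    using integrability1[OF assms(8)] integrability2[OF assms(8)] by blast
qed

end
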